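(* Let $U:\mathbb{R}\to\mathbb{R}$ be of the form $U(x)=\alpha\frac{|x|^2}{2}+\psi(x)$ for some $\alpha>0$ and some $\psi\in\mathcal{C}^2(\mathbb{R})$ compactly supported on $[-R,R]$, $R>0$, such that the smallness condition (S) stated in the context holds. Then there are a symmetric positive definite matrix $A\in\mathcal{M}_2(\mathbb{R})$ and $\kappa>0$ such that for any probability measure $f\in\mathcal{P}_2(\mathbb{R}^2)$ having a $\mathcal{C}^1$, strictly positive density, $$\kappa\, W_A^2(f,f_\infty)\le\mathcal{J}_A(f|f_\infty).$$
   Context: $\mathcal{P}_2(\mathbb{R}^2)$ is the set of Borel probability measures on $\mathbb{R}^2$ with finite second moment; points of $\mathbb{R}^2$ are written $(x,v)$. Probability measures and their densities are identified. $f_\infty(x,v)=Z^{-1}e^{-U(x)-\frac{|v|^2}{2}}$ with $Z=\sqrt{2\pi}\int_{\mathbb{R}}e^{-U(y)}dy$. For a symmetric positive definite $A=\begin{pmatrix} a & b \\ b & c \end{pmatrix}$, $\langle z,z'\rangle_A:=z\cdot Az'$ and $|z|_A^2:=z\cdot Az$ for $z,z'\in\mathbb{R}^2$, and for $\mu,\nu\in\mathcal{P}_2(\mathbb{R}^2)$, $$W_A^2(\mu,\nu)=\inf_{\gamma\in\Pi(\mu,\nu)}\int_{\mathbb{R}^2\times\mathbb{R}^2}|z_1-z_2|_A^2\,\gamma(dz_1,dz_2),$$ where $\Pi(\mu,\nu)$ is the set of probability measures on $\mathbb{R}^2\times\mathbb{R}^2$ with first marginal $\mu$ and second marginal $\nu$.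 $B(x,v)=\begin{pmatrix} v \\ -U'(x)-v \end{pmatrix}$. For $f,g\in\mathcal{P}_2(\mathbb{R}^2)$ with $\mathcal{C}^1$, strictly positive densities, let $\varphi$ be the (unique up to an additive constant) convex function on $\mathbb{R}^2$ such that the map $A^{-1}\nabla\varphi$ pushes $g$ forward onto $f$ and is optimal for $W_A$, i.e. $W_A^2(f,g)=\int_{\mathbb{R}^2}|(x,v)-A^{-1}\nabla\varphi(x,v)|_A^2\,g(x,v)dxdv$; this $\varphi$ is $\mathcal{C}^2$ with positive definite Hessian. Define $$\mathcal{J}_A(f|g):=-\int_{\mathbb{R}^2}\langle B(A^{-1}\nabla\varphi(x,v))-B(x,v),\,A^{-1}\nabla\varphi(x,v)-(x,v)\rangle_A\,g(x,v)dxdv$$ $$+\int_{\mathbb{R}^2}(\partial_v^2\varphi)^{-1}\left((\partial_v^2\varphi-c)^2+\frac{\bigl(b(\partial_v^2\varphi-c)-c(\partial_{x,v}^2\varphi-b)\bigr)^2}{\det(\nabla^2\varphi)}\right)g(x,v)dxdv.$$ Smallness condition (S) on $(\alpha,\psi,R)$: with $\gamma:=\|\psi''\|_{L^\infty}-\alpha$, $$b_*:=(\gamma+\|\psi''\|_{L^\infty}^2)\frac{2}{1+\sqrt{1-2(\gamma+\|\psi''\|_{L^\infty})}},$$ $$c_*:=\frac1{20}e^{-\frac{\alpha}{2}(R+2)^2}e^{-\|\psi\|_{L^\infty}}\Bigl(1\wedge\frac{\alpha-2\|\psi'\|_{L^\infty}}{4}\Bigr),$$ one requires $2\|\psi'\|_{L^\infty}<\alpha<\|\psi''\|_{L^\infty}<10^{-1}$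 and $c_*>2b_*$. Here $s\wedge t=\min(s,t)$. *)

theory Defs
  imports "HOL-Probability.Probability"
begin

text \<open>Points of the phase space \<open>real^2\<close> are \<open>(x, v) = (z $ 1, z $ 2)\<close>; a matrix \<open>A :: real^2^2\<close>
  has entries \<open>a = A $ 1 $ 1\<close>, \<open>b = A $ 1 $ 2\<close>, \<open>c = A $ 2 $ 2\<close>.\<close>

definition grad :: "(real^2 \<Rightarrow> real) \<Rightarrow> real^2 \<Rightarrow> real^2" where
  "grad \<phi> z = (\<chi> i. frechet_derivative \<phi> (at z) (axis i 1))"

definition hess :: "(real^2 \<Rightarrow> real) \<Rightarrow> real^2 \<Rightarrow> real^2^2" where
  "hess \<phi> z = jacobian (grad \<phi>) (at z)"

definition C1_plane :: "(real^2 \<Rightarrow> real) \<Rightarrow> bool" where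
  "C1_plane \<phi> \<longleftrightarrow> (\<forall>z. \<phi> differentiable (at z)) \<and> continuous_on UNIV (grad \<phi>)"

definition C2_plane :: "(real^2 \<Rightarrow> real) \<Rightarrow> bool" where
  "C2_plane \<phi> \<longleftrightarrow> C1_plane \<phi> \<and> (\<forall>z. grad \<phi> differentiable (at z)) \<and> continuous_on UNIV (hess \<phi>)"

definition C2_line :: "(real \<Rightarrow> real) \<Rightarrow> bool" where
  "C2_line \<psi> \<longleftrightarrow> (\<forall>x. \<psi> differentiable (at x)) \<and> (\<forall>x. deriv \<psi> differentiable (at x)) \<and>
     continuous_on UNIV (deriv (deriv \<psi>))"

definition sym_pos_def :: "real^2^2 \<Rightarrow> bool" where
  "sym_pos_def A \<longleftrightarrow> transpose A = A \<and> (\<forall>z. z \<noteq> 0 \<longrightarrow> 0 < z \<bullet> (A *v z))"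

definition inner_A :: "real^2^2 \<Rightarrow> real^2 \<Rightarrow> real^2 \<Rightarrow> real" where
  "inner_A A z w = z \<bullet> (A *v w)"

definition P2 :: "(real^2) measure set" where
  "P2 = {\<mu>. prob_space \<mu> \<and> sets \<mu> = sets borel \<and> (\<integral>\<^sup>+ z. ennreal ((norm z)\<^sup>2) \<partial>\<mu>) < \<infinity>}"

definition couplings ::
    "(real^2) measure \<Rightarrow> (real^2) measure \<Rightarrow> ((real^2) \<times> (real^2)) measure set" where
  "couplings \<mu> \<nu> = {\<gamma>. prob_space \<gamma> \<and> sets \<gamma> = sets borel \<and>
     distr \<gamma> borel fst = \<mu> \<and> distr \<gamma> borel snd = \<nu>}"

definition W_sq :: "real^2^2 \<Rightarrow> (real^2) measure \<Rightarrow> (real^2) measure \<Rightarrow> ennreal" where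
  "W_sq A \<mu> \<nu> = (INF \<gamma> \<in> couplings \<mu> \<nu>.
     \<integral>\<^sup>+ p. ennreal (inner_A A (fst p - snd p) (fst p - snd p)) \<partial>\<gamma>)"

text \<open>The measure with Lebesgue density \<open>f\<close>, with which \<open>f\<close> is identified.\<close>

definition meas :: "(real^2 \<Rightarrow> real) \<Rightarrow> (real^2) measure" where
  "meas f = density lborel (\<lambda>z. ennreal (f z))"

definition transport_map :: "real^2^2 \<Rightarrow> (real^2 \<Rightarrow> real) \<Rightarrow> real^2 \<Rightarrow> real^2" where
  "transport_map A \<phi> z = matrix_inv A *v grad \<phi> z"

text \<open>The potential \<open>\<phi>\<close> associated with \<open>(f|g)\<close>: convex, with \<open>A\<^sup>-\<^sup>1 \<nabla>\<phi>\<close> pushing \<open>g\<close> forward onto \<open>f\<close>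
  optimally. For \<open>C\<^sup>1\<close> strictly positive densities of finite second moment such a \<open>\<phi>\<close> exists, is
  unique up to an additive constant, and has the regularity recorded in the first line.\<close>

definition optimal_potential ::
    "real^2^2 \<Rightarrow> (real^2 \<Rightarrow> real) \<Rightarrow> (real^2 \<Rightarrow> real) \<Rightarrow> (real^2 \<Rightarrow> real) \<Rightarrow> bool" where
  "optimal_potential A f g \<phi> \<longleftrightarrow>
     C2_plane \<phi> \<and> (\<forall>z. sym_pos_def (hess \<phi> z)) \<and>
     convex_on UNIV \<phi> \<and>
     distr (meas g) borel (transport_map A \<phi>) = meas f \<and>
     W_sq A (meas f) (meas g) =
       (\<integral>\<^sup>+ z. ennreal (inner_A A (z - transport_map A \<phi> z) (z - transport_map A \<phi> z) * g z) \<partial>lborel)"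

definition drift :: "(real \<Rightarrow> real) \<Rightarrow> real^2 \<Rightarrow> real^2" where
  "drift U z = vector [z $ 2, - deriv U (z $ 1) - z $ 2]"

text \<open>\<open>\<J>\<^sub>A(f|g)\<close>, where \<open>\<phi>\<close> is the potential associated with \<open>(f|g)\<close>; it depends on \<open>\<phi>\<close> only through
  its derivatives, hence not on the additive constant, and on \<open>f\<close> only through \<open>\<phi>\<close>. The second
  integral has a nonnegative integrand and may be infinite, so the value is an extended real.\<close>

definition J_fun :: "(real \<Rightarrow> real) \<Rightarrow> real^2^2 \<Rightarrow> (real^2 \<Rightarrow> real) \<Rightarrow> (real^2 \<Rightarrow> real) \<Rightarrow> ereal" where
  "J_fun U A g \<phi> =
     (let T = transport_map A \<phi>; b = A $ 1 $ 2; c = A $ 2 $ 2;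
          vv = (\<lambda>z. hess \<phi> z $ 2 $ 2); xv = (\<lambda>z. hess \<phi> z $ 1 $ 2)
      in ereal (- (LINT z|lborel. inner_A A (drift U (T z) - drift U z) (T z - z) * g z))
       + enn2ereal (\<integral>\<^sup>+ z. ennreal (inverse (vv z) *
             ((vv z - c)\<^sup>2 + (b * (vv z - c) - c * (xv z - b))\<^sup>2 / det (hess \<phi> z)) * g z) \<partial>lborel))"

definition f_inf :: "(real \<Rightarrow> real) \<Rightarrow> real^2 \<Rightarrow> real" where
  "f_inf U z = exp (- U (z $ 1) - \<bar>z $ 2\<bar>\<^sup>2 / 2) / (sqrt (2 * pi) * (LINT y|lborel. exp (- U y)))"

text \<open>Real-valued, to be used for essentially bounded functions only.\<close>

definition Linf_norm :: "(real \<Rightarrow> real) \<Rightarrow> real" where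
  "Linf_norm h = real_of_ereal (esssup lborel (\<lambda>x. ereal \<bar>h x\<bar>))"

definition b_star :: "real \<Rightarrow> (real \<Rightarrow> real) \<Rightarrow> real" where
  "b_star \<alpha> \<psi> =
     (let m = Linf_norm (deriv (deriv \<psi>)); \<gamma> = m - \<alpha>
      in (\<gamma> + m\<^sup>2) * (2 / (1 + sqrt (1 - 2 * (\<gamma> + m)))))"

definition c_star :: "real \<Rightarrow> (real \<Rightarrow> real) \<Rightarrow> real \<Rightarrow> real" where
  "c_star \<alpha> \<psi> R =
     1 / 20 * exp (- (\<alpha> / 2) * (R + 2)\<^sup>2) * exp (- Linf_norm \<psi>)
       * min 1 ((\<alpha> - 2 * Linf_norm (deriv \<psi>)) / 4)"

definition smallness :: "real \<Rightarrow> (real \<Rightarrow> real) \<Rightarrow> real \<Rightarrow> bool" where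
  "smallness \<alpha> \<psi> R \<longleftrightarrow>
     2 * Linf_norm (deriv \<psi>) < \<alpha> \<and> \<alpha> < Linf_norm (deriv (deriv \<psi>)) \<and>
     Linf_norm (deriv (deriv \<psi>)) < 1 / 10 \<and> c_star \<alpha> \<psi> R > 2 * b_star \<alpha> \<psi>"

end

theory Submission
  imports Defs
begin

text \<open>Take \<open>A\<close> with entries \<open>a = b = 1\<close> and \<open>c = 2\<close>. Write \<open>(\<xi>, \<eta>)\<close> for the displacement \<open>T z - z\<close> of the optimal
  map \<open>T\<close>, with \<open>z = (x, v)\<close>, and put \<open>h = \<xi> + 2 \<eta> = \<partial>\<^sub>v\<phi> - x - 2 v\<close>. The drift part of \<open>\<J>\<close> then has the integrand
  \<open>\<eta>\<^sup>2 + h (U'(x + \<xi>) - U'(x))\<close>. Here \<open>\<xi>\<close> may be replaced by \<open>h\<close> at the price of a part of \<open>\<eta>\<^sup>2\<close> and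
  of a small multiple of \<open>h\<^sup>2\<close> (\<open>pointwise_reduction\<close>), so for uniformly convex \<open>U\<close> one would be done. The difficulty lies in those
  \<open>x\<close> and \<open>h\<close> for which \<open>h (U'(x + h) - U'(x))\<close> is slightly negative.

  By the smallness condition this defect is at most \<open>\<gamma> h\<^sup>2\<close>, with \<open>\<gamma>\<close> tiny compared with \<open>\<beta> = \<alpha> - 2 sup \<bar>\<psi>'\<bar>\<close>. Moreover, the
  defect disappears at unit scale: since \<open>\<bar>\<psi>'\<bar> < \<alpha> / 2\<close>, one has \<open>h (U'(x + h) - U'(x)) \<ge> \<beta> h\<^sup>2\<close> as soon as
  \<open>\<bar>h\<bar> \<ge> 1\<close>, and for constant \<open>h\<close> the same bound holds in the mean over every window \<open>n \<le> x \<le> n + 1\<close>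
  (\<open>mildly_nonconvex_of_smallness\<close>). So it suffices that \<open>h\<close> does not vary too much in \<open>x\<close> on a window.

  This is what the second part of \<open>\<J>\<close> provides. Its integrand \<open>Q\<close> is the squared length of the gradient of \<open>h\<close> in the
  metric given by the inverse of \<open>\<nabla>\<^sup>2\<phi>\<close>, hence \<open>(\<partial>\<^sub>xh)\<^sup>2 \<le> Q \<partial>\<^sub>x\<^sup>2\<phi>\<close> (\<open>off_diagonal_le_dissipation\<close>). The Hessian is not
  bounded, but the integral of \<open>\<partial>\<^sub>x\<^sup>2\<phi>\<close> over a segment is the increment of \<open>\<partial>\<^sub>x\<phi> = x + v + h - \<eta>\<close>. So the square of the
  increment of \<open>h\<close> is bounded by the integral of \<open>Q\<close> times one plus terms in the increment of \<open>h\<close> and in \<open>\<eta>\<close> at the end points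
  (\<open>increment_square_le\<close>), which yields the inequality on each window at fixed \<open>v\<close>
  (\<open>window_nonneg\<close>). Summation over the windows and integration in \<open>v\<close> conclude
  (\<open>integral_plane_nonneg\<close>, \<open>W_sq_le_J_fun\<close>), with \<open>\<kappa> = \<beta> / 160\<close>.\<close>

section \<open>Increments bounded by a dissipation\<close>

lemma square_le_prod_of_quadratic:
  fixes d E F :: real
  assumes "\<And>l. 2 * l * d \<le> l\<^sup>2 * E + F" "0 \<le> E"
  shows "d\<^sup>2 \<le> E * F"
proof (cases "E = 0")
  case True
  have "d = 0"
  proof (rule ccontr)
    assume "d \<noteq> 0"
    then show False using assms(1)[of "(F + 1) / (2 * d)"] True by simp
  qed
  then show ?thesis using True by simp
next
  case False
  then have E: "E > 0" using assms(2) by simp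
  have "2 * (d / E) * d \<le> (d / E)\<^sup>2 * E + F" by (rule assms(1))
  then have "d\<^sup>2 / E \<le> F" using E by (simp add: power2_eq_square field_simps)
  then show ?thesis using E by (simp add: field_simps)
qed

text \<open>A Cauchy--Schwarz inequality for the increment of \<open>h\<close>, where the second factor is the integral of \<open>F'\<close>
  and hence again an increment. It is used with \<open>F = \<partial>\<^sub>x\<phi>\<close>, whose derivative has no pointwise bound.
  Integrating the linearised inequality with a free parameter \<open>l\<close> needs only that
  derivatives are integrable, not their square roots or products.\<close>
lemma increment_square_le:
  fixes h F Q :: "real \<Rightarrow> real"
  assumes "p \<le> q"
    and h: "\<And>x. x \<in> {p..q} \<Longrightarrow> (h has_real_derivative h' x) (at x)"
    and F: "\<And>x. x \<in> {p..q} \<Longrightarrow> (F has_real_derivative F' x) (at x)"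
    and Q: "continuous_on {p..q} Q" and Q0: "\<And>x. x \<in> {p..q} \<Longrightarrow> 0 \<le> Q x"
    and F0: "\<And>x. x \<in> {p..q} \<Longrightarrow> 0 \<le> F' x"
    and le: "\<And>x. x \<in> {p..q} \<Longrightarrow> (h' x)\<^sup>2 \<le> Q x * F' x"
  shows "(h q - h p)\<^sup>2 \<le> integral {p..q} Q * (F q - F p)"
proof (rule square_le_prod_of_quadratic)
  have Qi: "(Q has_integral integral {p..q} Q) {p..q}"
    using Q integrable_continuous_real by blast
  then show "0 \<le> integral {p..q} Q" using Q0 by (rule has_integral_nonneg)
  fix l :: real
  have hi: "(h' has_integral h q - h p) {p..q}"
    by (rule fundamental_theorem_of_calculus)
       (use assms(1) h in \<open>auto simp: has_real_derivative_iff_has_vector_derivative[symmetric] intro: DERIV_subset\<close>)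
  have Fi: "(F' has_integral F q - F p) {p..q}"
    by (rule fundamental_theorem_of_calculus)
       (use assms(1) F in \<open>auto simp: has_real_derivative_iff_has_vector_derivative[symmetric] intro: DERIV_subset\<close>)
  show "2 * l * (h q - h p) \<le> l\<^sup>2 * integral {p..q} Q + (F q - F p)"
  proof (rule has_integral_le)
    show "((\<lambda>x. 2 * l * h' x) has_integral 2 * l * (h q - h p)) {p..q}"
      using hi by (rule has_integral_mult_right)
    show "((\<lambda>x. l\<^sup>2 * Q x + F' x) has_integral l\<^sup>2 * integral {p..q} Q + (F q - F p)) {p..q}"
      by (intro has_integral_add has_integral_mult_right Qi Fi)
    fix x assume x: "x \<in> {p..q}"
    have "(2 * l * h' x)\<^sup>2 \<le> (2 * l)\<^sup>2 * (Q x * F' x)"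
      using le[OF x] by (simp add: power_mult_distrib mult_left_mono)
    also have "\<dots> \<le> (l\<^sup>2 * Q x + F' x)\<^sup>2"
      using zero_le_power2[of "l\<^sup>2 * Q x - F' x"] by (simp add: power2_eq_square algebra_simps)
    finally show "2 * l * h' x \<le> l\<^sup>2 * Q x + F' x"
      by (rule power2_le_imp_le) (simp add: Q0[OF x] F0[OF x])
  qed
qed

lemma neg_mult_le:
  fixes a b c :: real
  assumes "\<bar>b\<bar> \<le> c"
  shows "- (a * b) \<le> \<bar>a\<bar> * c"
proof -
  have "\<bar>a * b\<bar> \<le> \<bar>a\<bar> * c" using assms by (simp add: abs_mult mult_left_mono)
  then show ?thesis by linarith
qed

lemma has_integral_const_unit: "((\<lambda>_. c) has_integral c) {n..n + 1}" for c n :: real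
  using has_integral_const_real[of c n "n + 1"] by simp

text \<open>Absorbs the increment \<open>d\<close> of \<open>h\<close> over a window, which also occurs on the right-hand side, by Young's inequality. This
  produces a term in \<open>E\<^sup>2\<close>, and the smallness of \<open>E\<close> turns it into a multiple of \<open>E\<close>.\<close>
lemma oscillation_le:
  fixes d E p q :: real
  assumes "d\<^sup>2 \<le> E * (1 + \<bar>d\<bar> + \<bar>p\<bar> + \<bar>q\<bar>)" "0 \<le> E" "E \<le> 1 / 3" "q\<^sup>2 \<le> p\<^sup>2"
  shows "d\<^sup>2 \<le> 8 / 3 * E + 2 / 3 * p\<^sup>2"
proof -
  have "E * \<bar>d\<bar> \<le> E\<^sup>2 + d\<^sup>2 / 4"
    using zero_le_power2[of "E - \<bar>d\<bar> / 2"] by (simp add: power2_eq_square algebra_simps abs_mult_self_eq)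
  moreover have "E * \<bar>p\<bar> \<le> E\<^sup>2 + p\<^sup>2 / 4"
    using zero_le_power2[of "E - \<bar>p\<bar> / 2"] by (simp add: power2_eq_square algebra_simps abs_mult_self_eq)
  moreover have "E * \<bar>q\<bar> \<le> E\<^sup>2 + q\<^sup>2 / 4"
    using zero_le_power2[of "E - \<bar>q\<bar> / 2"] by (simp add: power2_eq_square algebra_simps abs_mult_self_eq)
  moreover have "3 * E\<^sup>2 \<le> E"
    using mult_left_mono[OF assms(3,2)] by (simp add: power2_eq_square)
  ultimately show ?thesis using assms(1,4) by (simp add: algebra_simps)
qed

section \<open>The one-dimensional estimate at fixed velocity\<close>

text \<open>The properties of the potential that the argument in the \<open>x\<close> variable needs: the failure of monotonicity
  of \<open>U'\<close> is of size \<open>\<gamma>\<close>, much smaller than the monotonicity \<open>\<beta>\<close> that is seen over distances of order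
  one, either by displacements of length at least one (\<open>far\<close>) or in the mean over windows of unit length
  (\<open>window_mean\<close>). Outside \<open>[- R - 1, R + 1]\<close> the monotonicity is pointwise, and inside
  \<open>[- R - 2, R + 2]\<close> the slope is so small that the weight \<open>exp (- U)\<close> is nearly constant on each
  window.\<close>
locale mildly_nonconvex_potential =
  fixes U dU :: "real \<Rightarrow> real" and m \<beta> \<gamma> R :: real
  assumes dU: "\<And>x. (U has_real_derivative dU x) (at x)"
    and lip: "\<And>x y. \<bar>dU y - dU x\<bar> \<le> 2 * m * \<bar>y - x\<bar>"
    and lower: "\<And>x t. - \<gamma> * t\<^sup>2 \<le> t * (dU (x + t) - dU x)"
    and far: "\<And>x t. 1 \<le> \<bar>t\<bar> \<Longrightarrow> \<beta> * t\<^sup>2 \<le> t * (dU (x + t) - dU x)"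
    and tail: "\<And>x t. R + 1 < \<bar>x\<bar> \<Longrightarrow> \<beta> * t\<^sup>2 \<le> t * (dU (x + t) - dU x)"
    and window_mean: "\<And>n t. \<beta> * t\<^sup>2 \<le> t * ((U (n + 1 + t) - U (n + t)) - (U (n + 1) - U n))"
    and slope: "\<And>x. \<bar>x\<bar> \<le> R + 2 \<Longrightarrow> \<bar>dU x\<bar> \<le> 3 / 25"
    and m: "0 < m" "160 * m\<^sup>2 \<le> \<beta>" "m < 1 / 160"
    and \<beta>: "0 < \<beta>" "\<beta> < 1 / 160"
    and \<gamma>: "0 \<le> \<gamma>" "160 * \<gamma> \<le> \<beta>"
begin

lemma continuous_U: "continuous_on S U"
  using dU by (meson DERIV_continuous continuous_at_imp_continuous_on)

lemma continuous_dU: "continuous_on S dU"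
proof -
  have "(2 * m)-lipschitz_on UNIV dU"
    by (rule lipschitz_onI) (use lip m in \<open>auto simp: dist_real_def\<close>)
  then show ?thesis using lipschitz_on_continuous_on continuous_on_subset by blast
qed

lemma continuous_dU_compose: "continuous_on S f \<Longrightarrow> continuous_on S (\<lambda>x. dU (f x))"
  using continuous_on_compose2[OF continuous_dU[of UNIV]] by auto

lemma deriv_U: "deriv U = dU"
  using dU DERIV_imp_deriv by blast

lemma weight_ratio:
  assumes "\<bar>x\<bar> \<le> R + 2" "\<bar>y\<bar> \<le> R + 2" "\<bar>x - y\<bar> \<le> 1"
  shows "exp (- U x) \<le> 57 / 50 * exp (- U y)"
proof -
  have "\<bar>U x - U y\<bar> \<le> 3 / 25 * \<bar>x - y\<bar>"
  proof -
    have "norm (U x - U y) \<le> 3 / 25 * norm (x - y)"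
    proof (rule field_differentiable_bound)
      show "convex {- (R + 2)..R + 2}" by simp
      fix z assume "z \<in> {- (R + 2)..R + 2}"
      then show "norm (dU z) \<le> 3 / 25" using slope[of z] by (auto simp: abs_le_iff)
    qed (use assms dU in \<open>auto intro: DERIV_subset\<close>)
    then show ?thesis by simp
  qed
  then have d: "U y - U x \<le> 3 / 25" using mult_left_mono[OF assms(3), of "3 / 25"] by linarith
  have "exp (- U x) = exp (U y - U x) * exp (- U y)" by (simp add: exp_diff exp_minus field_simps)
  moreover have "exp (U y - U x) \<le> exp (3 / 25)" using d by simp
  moreover have "exp (3 / 25 :: real) \<le> 57 / 50"
    using exp_bound[of "3 / 25"] by (simp add: power2_eq_square)
  ultimately have "exp (U y - U x) * exp (- U y) \<le> 57 / 50 * exp (- U y)"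
    by (intro mult_right_mono) (erule order_trans, auto)
  then show ?thesis using \<open>exp (- U x) = _\<close> by simp
qed

text \<open>Replacing the displacement \<open>t\<close> by a reference displacement \<open>s\<close> costs a fraction of \<open>\<beta> s\<^sup>2\<close> and a multiple
  of \<open>(t - s)\<^sup>2\<close> that does not depend on \<open>\<beta>\<close>: the cross term \<open>4 m \<bar>s\<bar> \<bar>t - s\<bar>\<close> is absorbed thanks to
  \<open>160 m\<^sup>2 \<le> \<beta>\<close>.\<close>
lemma shift_reference:
  "t * (dU (x + t) - dU x) - \<beta> / 16 * t\<^sup>2 \<ge>
     s * (dU (x + s) - dU x) - \<beta> / 4 * s\<^sup>2 - 11 / 50 * (t - s)\<^sup>2"
proof -
  define z where "z = t - s"
  have a: "\<bar>dU (x + t) - dU (x + s)\<bar> \<le> 2 * m * \<bar>z\<bar>"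
    using lip[of "x + t" "x + s"] by (simp add: z_def)
  have b: "\<bar>dU (x + t) - dU x\<bar> \<le> 2 * m * \<bar>t\<bar>"
    using lip[of "x + t" x] by simp
  have e: "t * (dU (x + t) - dU x) =
     s * (dU (x + s) - dU x) + s * (dU (x + t) - dU (x + s)) + z * (dU (x + t) - dU x)"
    by (simp add: z_def algebra_simps)
  have "- (s * (dU (x + t) - dU (x + s))) \<le> \<bar>s\<bar> * (2 * m * \<bar>z\<bar>)"
    by (rule neg_mult_le[OF a])
  moreover have "- (z * (dU (x + t) - dU x)) \<le> \<bar>z\<bar> * (2 * m * (\<bar>s\<bar> + \<bar>z\<bar>))"
  proof -
    have "\<bar>dU (x + t) - dU x\<bar> \<le> 2 * m * (\<bar>s\<bar> + \<bar>z\<bar>)"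
    proof -
      have "2 * m * \<bar>t\<bar> \<le> 2 * m * (\<bar>s\<bar> + \<bar>z\<bar>)"
        using m(1) by (intro mult_left_mono) (auto simp: z_def)
      with b show ?thesis by linarith
    qed
    then show ?thesis by (rule neg_mult_le)
  qed
  ultimately have 1: "t * (dU (x + t) - dU x) \<ge>
      s * (dU (x + s) - dU x) - 4 * m * (\<bar>s\<bar> * \<bar>z\<bar>) - 2 * m * z\<^sup>2"
    unfolding e by (simp add: algebra_simps power2_eq_square abs_mult_self_eq)
  have 2: "4 * m * (\<bar>s\<bar> * \<bar>z\<bar>) \<le> \<beta> / 8 * s\<^sup>2 + 1 / 5 * z\<^sup>2"
  proof -
    have "(4 * m * (\<bar>s\<bar> * \<bar>z\<bar>))\<^sup>2 = 16 * m\<^sup>2 * (s\<^sup>2 * z\<^sup>2)" by (simp add: power_mult_distrib)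
    also have "\<dots> \<le> 16 * (\<beta> / 160) * (s\<^sup>2 * z\<^sup>2)"
      using m(2) by (intro mult_right_mono) auto
    also have "\<dots> = 4 * (\<beta> / 8 * s\<^sup>2) * (1 / 5 * z\<^sup>2)" by simp
    also have "\<dots> \<le> (\<beta> / 8 * s\<^sup>2 + 1 / 5 * z\<^sup>2)\<^sup>2"
      using zero_le_power2[of "\<beta> / 8 * s\<^sup>2 - 1 / 5 * z\<^sup>2"] by (simp add: power2_eq_square algebra_simps)
    finally show ?thesis by (rule power2_le_imp_le) (use \<beta> in auto)
  qed
  have "t\<^sup>2 \<le> 2 * s\<^sup>2 + 2 * z\<^sup>2"
    using zero_le_power2[of "s - z"] by (simp add: z_def power2_eq_square algebra_simps)
  then have 3: "\<beta> / 16 * t\<^sup>2 \<le> \<beta> / 8 * s\<^sup>2 + \<beta> / 8 * z\<^sup>2"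
    using mult_left_mono[of "t\<^sup>2" _ "\<beta> / 16"] \<beta> by (fastforce simp: algebra_simps)
  have 4: "(2 * m + \<beta> / 8) * z\<^sup>2 \<le> 1 / 50 * z\<^sup>2"
    using m \<beta> by (intro mult_right_mono) auto
  show ?thesis using 1 2 3 4 unfolding z_def[symmetric] by (simp add: algebra_simps)
qed

text \<open>The displacement in \<open>x\<close> is \<open>h - 2 \<eta>\<close>. Half of \<open>\<eta>\<^sup>2\<close> and a multiple of \<open>m\<^sup>2 h\<^sup>2\<close> pay for replacing it by \<open>h\<close>, the quantity whose
  variation in \<open>x\<close> is controlled. The polynomial multiplied by \<open>\<beta> / 160\<close> is the transport
  cost.\<close>
lemma pointwise_reduction:
  "\<eta>\<^sup>2 + h * (dU (x + (h - 2 * \<eta>)) - dU x) - \<beta> / 160 * (h\<^sup>2 - 2 * h * \<eta> + 2 * \<eta>\<^sup>2) \<ge>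
     49 / 100 * \<eta>\<^sup>2 + (h * (dU (x + h) - dU x) - \<beta> / 16 * h\<^sup>2)"
proof -
  have a: "\<bar>dU (x + (h - 2 * \<eta>)) - dU (x + h)\<bar> \<le> 4 * m * \<bar>\<eta>\<bar>"
    using lip[of "x + (h - 2 * \<eta>)" "x + h"] by (simp add: abs_mult)
  have "- (h * (dU (x + (h - 2 * \<eta>)) - dU (x + h))) \<le> \<bar>h\<bar> * (4 * m * \<bar>\<eta>\<bar>)"
    by (rule neg_mult_le[OF a])
  also have "\<dots> \<le> 8 * m\<^sup>2 * h\<^sup>2 + 1 / 2 * \<eta>\<^sup>2"
    using zero_le_power2[of "4 * m * \<bar>h\<bar> - \<bar>\<eta>\<bar>"]
    by (simp add: power2_diff power_mult_distrib algebra_simps)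
  finally have 1: "h * (dU (x + (h - 2 * \<eta>)) - dU x) \<ge>
      h * (dU (x + h) - dU x) - 8 * m\<^sup>2 * h\<^sup>2 - 1 / 2 * \<eta>\<^sup>2" by (simp add: algebra_simps)
  have 2: "8 * m\<^sup>2 * h\<^sup>2 \<le> \<beta> / 20 * h\<^sup>2" using m(2) by (intro mult_right_mono) auto
  have "h\<^sup>2 - 2 * h * \<eta> + 2 * \<eta>\<^sup>2 \<le> 2 * h\<^sup>2 + 3 * \<eta>\<^sup>2"
    using zero_le_power2[of "h + \<eta>"] by (simp add: power2_eq_square algebra_simps)
  then have 3: "\<beta> / 160 * (h\<^sup>2 - 2 * h * \<eta> + 2 * \<eta>\<^sup>2) \<le> \<beta> / 160 * (2 * h\<^sup>2 + 3 * \<eta>\<^sup>2)"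
    using \<beta> by (intro mult_left_mono) auto
  have 4: "3 * \<beta> / 160 * \<eta>\<^sup>2 \<le> 1 / 100 * \<eta>\<^sup>2" using \<beta> by (intro mult_right_mono) auto
  show ?thesis using 1 2 3 4 by (simp add: algebra_simps)
qed

lemma has_integral_increment:
  "((\<lambda>x. dU (x + t) - dU x) has_integral (U (n + 1 + t) - U (n + t)) - (U (n + 1) - U n)) {n..n + 1}"
proof -
  have "((\<lambda>x. U (x + t) - U x) has_real_derivative dU (x + t) - dU x) (at x within {n..n + 1})" for x
    using dU[of "x + t"] dU[of x]
    by (intro DERIV_diff) (auto simp: DERIV_shift intro: has_field_derivative_at_within)
  then have "((\<lambda>x. dU (x + t) - dU x) has_integral (U (n + 1 + t) - U (n + 1)) - (U (n + t) - U n)) {n..n + 1}"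
    by (intro fundamental_theorem_of_calculus)
       (auto simp: has_real_derivative_iff_has_vector_derivative[symmetric])
  then show ?thesis by (simp add: algebra_simps)
qed

text \<open>For a constant displacement the mean monotonicity over a window survives the weight: the negative part of
  \<open>s * (dU (x + s) - dU x)\<close> is at most \<open>\<gamma> s\<^sup>2\<close>, so after adding \<open>\<gamma> s\<^sup>2\<close> the weight can be bounded below by
  its minimum \<open>w\<close>.\<close>
lemma weighted_window_mean:
  assumes "\<And>x. x \<in> {n..n + 1} \<Longrightarrow> w \<le> exp (- U x)"
    and "\<And>x. x \<in> {n..n + 1} \<Longrightarrow> exp (- U x) \<le> 57 / 50 * w" and "0 < w"
  shows "0 \<le> integral {n..n + 1} (\<lambda>x. (s * (dU (x + s) - dU x) - \<beta> / 4 * s\<^sup>2) * exp (- U x))"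
proof -
  let ?D = "\<lambda>x. s * (dU (x + s) - dU x)"
  have "(\<lambda>x. ?D x + \<gamma> * s\<^sup>2) integrable_on {n..n + 1}"
    by (intro integrable_continuous_real continuous_intros continuous_dU_compose)
  have L: "((\<lambda>x. w * (?D x + \<gamma> * s\<^sup>2) - 57 / 50 * w * (\<gamma> + \<beta> / 4) * s\<^sup>2) has_integral
      w * (s * ((U (n + 1 + s) - U (n + s)) - (U (n + 1) - U n)) + \<gamma> * s\<^sup>2) - 57 / 50 * w * (\<gamma> + \<beta> / 4) * s\<^sup>2) {n..n + 1}"
    by (intro has_integral_const_unit has_integral_diff has_integral_mult_right has_integral_add has_integral_increment)
  have "0 \<le> w * (\<beta> * s\<^sup>2 + \<gamma> * s\<^sup>2) - 57 / 50 * w * (\<gamma> + \<beta> / 4) * s\<^sup>2"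
  proof -
    have "0 \<le> w * s\<^sup>2 * (\<beta> + \<gamma> - 57 / 50 * (\<gamma> + \<beta> / 4))"
      using \<gamma> \<beta> assms(3) by (intro mult_nonneg_nonneg) auto
    then show ?thesis by (simp add: algebra_simps)
  qed
  also have "\<dots> \<le> w * (s * ((U (n + 1 + s) - U (n + s)) - (U (n + 1) - U n)) + \<gamma> * s\<^sup>2)
      - 57 / 50 * w * (\<gamma> + \<beta> / 4) * s\<^sup>2"
    using window_mean[of s n] assms(3) by simp
  also have "\<dots> \<le> integral {n..n + 1} (\<lambda>x. (?D x - \<beta> / 4 * s\<^sup>2) * exp (- U x))"
  proof (rule has_integral_le[OF L])
    show "((\<lambda>x. (?D x - \<beta> / 4 * s\<^sup>2) * exp (- U x)) has_integral
       integral {n..n + 1} (\<lambda>x. (?D x - \<beta> / 4 * s\<^sup>2) * exp (- U x))) {n..n + 1}"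
      by (intro integrable_integral integrable_continuous_real continuous_intros continuous_dU_compose continuous_U)
    fix x assume x: "x \<in> {n..n + 1}"
    have "w * (?D x + \<gamma> * s\<^sup>2) \<le> exp (- U x) * (?D x + \<gamma> * s\<^sup>2)"
      using lower[of s x] assms(1)[OF x] by (intro mult_right_mono) auto
    moreover have "exp (- U x) * ((\<gamma> + \<beta> / 4) * s\<^sup>2) \<le> 57 / 50 * w * ((\<gamma> + \<beta> / 4) * s\<^sup>2)"
      using \<gamma> \<beta> assms(2)[OF x] by (intro mult_right_mono) auto
    ultimately show "w * (?D x + \<gamma> * s\<^sup>2) - 57 / 50 * w * (\<gamma> + \<beta> / 4) * s\<^sup>2
        \<le> (?D x - \<beta> / 4 * s\<^sup>2) * exp (- U x)" by argo
  qed
  finally show ?thesis .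
qed

text \<open>The core estimate. On a window that meets \<open>[- R - 1, R + 1]\<close>, let \<open>E\<close> be the integral of \<open>Q\<close>. If \<open>E\<close> is
  not small, it outweighs the possible defect, which is bounded because displacements of length at least one
  are harmless. If \<open>E\<close> is small, \<open>h\<close> is nearly constant up to errors controlled by \<open>E\<close> and by \<open>\<eta>\<^sup>2\<close>, and a
  constant displacement is treated by the mean monotonicity over the window. On the other windows the integrand is
  nonnegative.\<close>
lemma window_nonneg:
  fixes h \<eta> Q F :: "real \<Rightarrow> real"
  assumes h: "\<And>x. (h has_real_derivative h' x) (at x)"
    and F: "\<And>x. (F has_real_derivative F' x) (at x)"
    and \<eta>: "continuous_on UNIV \<eta>"
    and Q: "continuous_on UNIV Q" and Q0: "\<And>x. 0 \<le> Q x"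
    and F0: "\<And>x. 0 \<le> F' x"
    and le: "\<And>x. (h' x)\<^sup>2 \<le> Q x * F' x"
    and Feq: "\<And>x. F x = x + v + h x - \<eta> x"
  shows "0 \<le> integral {n..n + 1}
    (\<lambda>x. (49 / 100 * (\<eta> x)\<^sup>2 + (h x * (dU (x + h x) - dU x) - \<beta> / 16 * (h x)\<^sup>2) + Q x) * exp (- U x))"
    (is "0 \<le> integral _ ?P")
proof -
  let ?I = "{n..n + 1}"
  let ?G = "\<lambda>x. h x * (dU (x + h x) - dU x) - \<beta> / 16 * (h x)\<^sup>2"
  have ch: "continuous_on S h" for S
    using h by (meson DERIV_continuous continuous_at_imp_continuous_on)
  have ce: "continuous_on S \<eta>" and cQ: "continuous_on S Q" for S
    using \<eta> Q continuous_on_subset by blast+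
  note cont = continuous_intros continuous_dU_compose continuous_U ch ce cQ
  have int: "?P integrable_on ?I"
    by (intro integrable_continuous_real cont)
  have Gfar: "0 \<le> ?G x" if "R + 1 < \<bar>x\<bar> \<or> 1 \<le> \<bar>h x\<bar>" for x
  proof -
    have "\<beta> * (h x)\<^sup>2 \<le> h x * (dU (x + h x) - dU x)" using that far tail by blast
    moreover have "\<beta> / 16 * (h x)\<^sup>2 \<le> \<beta> * (h x)\<^sup>2" using \<beta> by (intro mult_right_mono) auto
    ultimately show ?thesis by linarith
  qed
  have Gall: "- 1 / 100 \<le> ?G x" for x
  proof (cases "1 \<le> \<bar>h x\<bar>")
    case True
    then show ?thesis using Gfar[of x] by linarith
  next
    case False
    then have "(h x)\<^sup>2 \<le> 1" by (simp add: abs_square_le_1)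
    then have "(\<gamma> + \<beta> / 16) * (h x)\<^sup>2 \<le> (\<gamma> + \<beta> / 16) * 1" using \<gamma> \<beta> by (intro mult_left_mono) auto
    moreover have "\<gamma> + \<beta> / 16 \<le> 1 / 100" using \<gamma> \<beta> by linarith
    ultimately show ?thesis using lower[of "h x" x] by (simp add: algebra_simps)
  qed
  show ?thesis
  proof (cases "\<exists>x\<in>?I. \<bar>x\<bar> \<le> R + 1")
    case False
    show ?thesis
    proof (rule integral_nonneg[OF int])
      fix x assume "x \<in> ?I"
      then have "0 \<le> ?G x" using Gfar[of x] False by force
      then show "0 \<le> ?P x" using Q0[of x] by (intro mult_nonneg_nonneg add_nonneg_nonneg) auto
    qed
  next
    case True
    then have cen: "\<bar>x\<bar> \<le> R + 2" if "x \<in> ?I" for x using that by auto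
    obtain y0 where y0: "y0 \<in> ?I" "\<And>x. x \<in> ?I \<Longrightarrow> exp (- U y0) \<le> exp (- U x)"
      using continuous_attains_inf[of ?I "\<lambda>x. exp (- U x)"]
      by (metis atLeastAtMost_iff compact_Icc continuous_on_exp continuous_on_minus continuous_U
          empty_iff le_add_same_cancel1 order_refl zero_le_one)
    define w where "w = exp (- U y0)"
    have w: "0 < w" "\<And>x. x \<in> ?I \<Longrightarrow> w \<le> exp (- U x)" "\<And>x. x \<in> ?I \<Longrightarrow> exp (- U x) \<le> 57 / 50 * w"
      using y0 weight_ratio[OF cen cen] by (auto simp: w_def)
    define E where "E = integral ?I Q"
    have Ei: "(Q has_integral E) ?I" unfolding E_def
      by (intro integrable_integral integrable_continuous_real cQ)
    have E0: "0 \<le> E" using Ei Q0 by (rule has_integral_nonneg)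
    show ?thesis
    proof (cases "1 / 3 \<le> E")
      case True
      have L: "((\<lambda>x. w * Q x - 57 / 5000 * w) has_integral w * E - 57 / 5000 * w) ?I"
        by (intro has_integral_const_unit has_integral_diff has_integral_mult_right Ei)
      have "0 \<le> w * E - 57 / 5000 * w" using True w(1) mult_left_mono[OF True, of w] by simp
      also have "\<dots> \<le> integral ?I ?P"
      proof (rule has_integral_le[OF L integrable_integral[OF int]])
        fix x assume x: "x \<in> ?I"
        have "w * Q x \<le> exp (- U x) * Q x" using w(2)[OF x] Q0 by (intro mult_right_mono)
        moreover have "exp (- U x) * (- 1 / 100) \<le> exp (- U x) * ?G x" using Gall by (intro mult_left_mono) auto
        moreover have "0 \<le> exp (- U x) * (49 / 100 * (\<eta> x)\<^sup>2)" by simp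
        ultimately show "w * Q x - 57 / 5000 * w \<le> ?P x" using w(3)[OF x] by argo
      qed
      finally show ?thesis .
    next
      case False
      \<comment> \<open>Evaluating \<open>h\<close> where \<open>\<eta>\<^sup>2\<close> is minimal makes the error at the reference point bounded by the error at any \<open>x\<close>.\<close>
      obtain y where y: "y \<in> ?I" "\<And>x. x \<in> ?I \<Longrightarrow> (\<eta> y)\<^sup>2 \<le> (\<eta> x)\<^sup>2"
        using continuous_attains_inf[of ?I "\<lambda>x. (\<eta> x)\<^sup>2"] continuous_on_power[OF ce, of ?I 2]
        by (metis atLeastAtMost_iff compact_Icc empty_iff le_add_same_cancel1 order_refl zero_le_one)
      define s where "s = h y"
      have inc: "(h q - h p)\<^sup>2 \<le> E * (1 + \<bar>h q - h p\<bar> + \<bar>\<eta> p\<bar> + \<bar>\<eta> q\<bar>)"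
        if "p \<le> q" "p \<in> ?I" "q \<in> ?I" for p q
      proof -
        have "(h q - h p)\<^sup>2 \<le> integral {p..q} Q * (F q - F p)"
          by (rule increment_square_le[OF that(1) h F cQ Q0 F0 le])
        also have "\<dots> \<le> integral {p..q} Q * (1 + \<bar>h q - h p\<bar> + \<bar>\<eta> p\<bar> + \<bar>\<eta> q\<bar>)"
          using that Q0 by (intro mult_left_mono integral_nonneg integrable_continuous_real cQ) (auto simp: Feq)
        also have "\<dots> \<le> E * (1 + \<bar>h q - h p\<bar> + \<bar>\<eta> p\<bar> + \<bar>\<eta> q\<bar>)"
          using that Q0 unfolding E_def
          by (intro mult_right_mono integral_subset_le integrable_continuous_real cQ) auto
        finally show ?thesis .
      qed
      have osc: "(h x - s)\<^sup>2 \<le> 8 / 3 * E + 2 / 3 * (\<eta> x)\<^sup>2" if x: "x \<in> ?I" for x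
      proof (rule oscillation_le[OF _ E0])
        show "(\<eta> y)\<^sup>2 \<le> (\<eta> x)\<^sup>2" by (rule y(2)[OF x])
        show "(h x - s)\<^sup>2 \<le> E * (1 + \<bar>h x - s\<bar> + \<bar>\<eta> x\<bar> + \<bar>\<eta> y\<bar>)"
          using inc[OF _ x y(1)] inc[OF _ y(1) x]
          by (cases "x \<le> y") (auto simp: s_def power2_commute[of "h x"] abs_minus_commute[of "h x"] add_ac)
      qed (use False in simp)
      \<comment> \<open>The oscillation costs \<open>11 / 50 * 57 / 50 * 8 / 3 < 67 / 100\<close> of \<open>w * E\<close>: the three factors come from
        the change of reference, the weight ratio and the oscillation bound.\<close>
      let ?S = "\<lambda>x. (s * (dU (x + s) - dU x) - \<beta> / 4 * s\<^sup>2) * exp (- U x)"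
      have L: "((\<lambda>x. ?S x + w * (1 * Q x - 67 / 100 * E)) has_integral
           integral ?I ?S + w * (1 * E - 67 / 100 * E)) ?I"
        by (intro has_integral_const_unit has_integral_add has_integral_diff has_integral_mult_right Ei integrable_integral
             integrable_continuous_real cont)
      have "0 \<le> integral ?I ?S + w * (1 * E - 67 / 100 * E)"
        using weighted_window_mean[of n w s, OF w(2,3,1)] w(1) E0 by simp
      also have "\<dots> \<le> integral ?I ?P"
      proof (rule has_integral_le[OF L integrable_integral[OF int]])
        fix x assume x: "x \<in> ?I"
        let ?e = "exp (- U x)"
        have "?e * (h x - s)\<^sup>2 \<le> ?e * (8 / 3 * E + 2 / 3 * (\<eta> x)\<^sup>2)"
          using osc[OF x] by (intro mult_left_mono) auto
        moreover have "?e * (s * (dU (x + s) - dU x) - \<beta> / 4 * s\<^sup>2 - 11 / 50 * (h x - s)\<^sup>2) \<le> ?e * ?G x"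
          using shift_reference by (intro mult_left_mono) auto
        moreover have "?e * E \<le> 57 / 50 * w * E" using w(3)[OF x] E0 by (intro mult_right_mono)
        moreover have "w * Q x \<le> ?e * Q x" using w(2)[OF x] Q0 by (intro mult_right_mono)
        moreover have "0 \<le> ?e * (\<eta> x)\<^sup>2" "0 \<le> w * E" using w(1) E0 by simp_all
        ultimately show "?S x + w * (1 * Q x - 67 / 100 * E) \<le> ?P x" by argo
      qed
      finally show ?thesis .
    qed
  qed
qed

end

section \<open>Consequences of the smallness condition\<close>

text \<open>A closed set that contains almost every point contains every point, so for a continuous function the essential
  bound holds everywhere. Boundedness ensures that the essential supremum is a real number.\<close>
lemma abs_le_Linf_norm:
  assumes g: "continuous_on UNIV g" and C: "\<And>x. \<bar>g x\<bar> \<le> C"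
  shows "\<bar>g x\<bar> \<le> Linf_norm g"
proof -
  let ?s = "esssup lborel (\<lambda>x. ereal \<bar>g x\<bar>)"
  have [measurable]: "g \<in> borel_measurable borel" using g by (rule borel_measurable_continuous_onI)
  have ae: "AE x in lborel. ereal \<bar>g x\<bar> \<le> ?s" by (rule esssup_AE)
  have "?s \<le> ereal C" by (rule esssup_I) (use C in auto)
  moreover have "0 \<le> ?s"
  proof -
    have "esssup lborel (\<lambda>x :: real. 0 :: ereal) \<le> ?s" by (rule esssup_mono) auto
    then show ?thesis by (simp add: esssup_const)
  qed
  ultimately have s: "?s = ereal (Linf_norm g)"
    unfolding Linf_norm_def by (cases ?s) auto
  have "x \<in> {x. \<bar>g x\<bar> \<le> Linf_norm g}"
  proof (rule mem_closed_if_AE_lebesgue)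
    show "closed {x. \<bar>g x\<bar> \<le> Linf_norm g}"
      using g by (intro closed_Collect_le continuous_intros)
    show "AE x in lebesgue. x \<in> {x. \<bar>g x\<bar> \<le> Linf_norm g}"
      using ae unfolding s by (intro AE_completion) simp
  qed
  then show ?thesis by simp
qed

lemma abs_le_Linf_norm_compact_support:
  assumes g: "continuous_on UNIV g" and z: "\<And>x. x \<notin> {-R..R} \<Longrightarrow> g x = 0"
  shows "\<bar>g x\<bar> \<le> Linf_norm g"
proof -
  have "bounded (g ` {-R..R})"
    using g by (intro compact_imp_bounded compact_continuous_image) (auto intro: continuous_on_subset)
  then obtain C where C: "\<And>x. x \<in> {-R..R} \<Longrightarrow> \<bar>g x\<bar> \<le> C"
    unfolding bounded_iff by (metis imageI real_norm_def)
  have "\<bar>g x\<bar> \<le> max C 0" for x using C[of x] z[of x] by (cases "x \<in> {-R..R}") auto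
  then show ?thesis by (rule abs_le_Linf_norm[OF g])
qed

lemma deriv_eq_0_outside:
  fixes g :: "real \<Rightarrow> real"
  assumes "\<And>x. x \<notin> {-R..R} \<Longrightarrow> g x = 0" "x \<notin> {-R..R}"
  shows "deriv g x = 0"
proof -
  have "open (- {-R..R})" by (simp add: open_Compl)
  then have "(g has_field_derivative 0) (at x)"
    by (rule has_field_derivative_transform_within_open[OF DERIV_const[of 0]]) (use assms in auto)
  then show ?thesis by (rule DERIV_imp_deriv)
qed

text \<open>Since \<open>c_star\<close> is at most \<open>\<beta> exp (- \<alpha> (R + 2)\<^sup>2 / 2) / 80\<close> and \<open>b_star\<close> is at least \<open>m - \<alpha> + m\<^sup>2\<close>, the
  smallness condition makes both the nonconvexity \<open>m - \<alpha>\<close> and \<open>m\<^sup>2\<close> small compared with \<open>\<beta>\<close>. Its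
  exponential factor restricts \<open>R\<close>: it forces \<open>160 \<alpha> exp (\<alpha> (R + 2)\<^sup>2 / 2) < 1\<close>, whence a bound on
  \<open>\<alpha> (R + 2)\<close>.\<close>
lemma smallness_consequences:
  assumes "\<alpha> > 0" "smallness \<alpha> \<psi> R"
    and "0 \<le> Linf_norm \<psi>" "0 \<le> Linf_norm (deriv \<psi>)"
  defines "m \<equiv> Linf_norm (deriv (deriv \<psi>))" and "\<beta> \<equiv> \<alpha> - 2 * Linf_norm (deriv \<psi>)"
  shows "0 < \<beta>" "\<beta> \<le> \<alpha>" "\<alpha> < m" "160 * (m - \<alpha>) \<le> \<beta>" "160 * m\<^sup>2 \<le> \<beta>" "m < 1 / 160"
    "\<alpha> * (R + 2) < 28 / 250"
proof -
  let ?e = "exp (- (\<alpha> / 2) * (R + 2)\<^sup>2)"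
  from assms(2) have s: "0 < \<beta>" "\<alpha> < m" "m < 1 / 10" "c_star \<alpha> \<psi> R > 2 * b_star \<alpha> \<psi>"
    unfolding smallness_def m_def \<beta>_def by auto
  show "0 < \<beta>" "\<alpha> < m" by fact+
  show le: "\<beta> \<le> \<alpha>" unfolding \<beta>_def using assms(4) by simp
  have b: "m - \<alpha> + m\<^sup>2 \<le> b_star \<alpha> \<psi>"
  proof -
    define r where "r = sqrt (1 - 2 * (m - \<alpha> + m))"
    have "0 \<le> r" unfolding r_def using s assms(1) by simp
    moreover have "r \<le> 1" unfolding r_def using s assms(1) by simp
    ultimately have "1 \<le> 2 / (1 + r)" by simp
    then have "(m - \<alpha> + m\<^sup>2) * 1 \<le> (m - \<alpha> + m\<^sup>2) * (2 / (1 + r))"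
      using s by (intro mult_left_mono) auto
    then show ?thesis unfolding b_star_def Let_def m_def[symmetric] r_def by simp
  qed
  have c: "c_star \<alpha> \<psi> R \<le> 1 / 20 * ?e * 1 * (\<beta> / 4)"
    unfolding c_star_def \<beta>_def[symmetric] using assms(3) s(1)
    by (intro mult_mono) auto
  \<comment> \<open>The factor \<open>160 = 2 * 20 * 4\<close> collects the constants of the smallness condition.\<close>
  have key: "160 * (m - \<alpha> + m\<^sup>2) < \<beta> * ?e" using b c s(4) by argo
  have e1: "?e \<le> 1" using assms by simp
  then have be: "\<beta> * ?e \<le> \<beta> * 1" using s(1) by (intro mult_left_mono) auto
  show "160 * (m - \<alpha>) \<le> \<beta>" using key be zero_le_power2[of m] by argo
  show mb: "160 * m\<^sup>2 \<le> \<beta>" using key be s(2) by argo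
  have "160 * m * m < 1 * m" using mb le s(2) key be unfolding power2_eq_square by argo
  then have "160 * m < 1" using s(2) assms(1) mult_less_cancel_right_pos[of m] by auto
  then show "m < 1 / 160" by simp
  have "160 * \<alpha> * \<alpha> < ?e * \<alpha>"
  proof -
    have "\<alpha> * \<alpha> \<le> m * m" using s(2) assms(1) by (intro mult_mono) auto
    moreover have "\<beta> * ?e \<le> \<alpha> * ?e" using le by (intro mult_right_mono) auto
    ultimately show ?thesis using key s(2) unfolding power2_eq_square by argo
  qed
  then have ae: "160 * \<alpha> < ?e" using assms(1) mult_less_cancel_right_pos[of \<alpha>] by auto
  have "160 * \<alpha> * (\<alpha> / 2 * (R + 2)\<^sup>2) \<le> 160 * \<alpha> * exp (\<alpha> / 2 * (R + 2)\<^sup>2)"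
    using assms(1) exp_ge_add_one_self[of "\<alpha> / 2 * (R + 2)\<^sup>2"] by (intro mult_left_mono) linarith+
  also have "\<dots> < ?e * exp (\<alpha> / 2 * (R + 2)\<^sup>2)"
    using ae by (intro mult_strict_right_mono) auto
  also have "\<dots> = 1" by (simp add: exp_add[symmetric])
  \<comment> \<open>The left-hand side is \<open>80 (\<alpha> (R + 2))\<^sup>2\<close>, and \<open>1 / 80 < (28 / 250)\<^sup>2\<close>.\<close>
  finally have "(\<alpha> * (R + 2))\<^sup>2 < (28 / 250)\<^sup>2" by (simp add: power2_eq_square algebra_simps)
  then show "\<alpha> * (R + 2) < 28 / 250" by (rule power2_less_imp_less) simp
qed

text \<open>Oscillations of \<open>\<psi>''\<close> are invisible over unit distances: increments of \<open>\<psi>'\<close> are at most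
  \<open>2 sup \<bar>\<psi>'\<bar> < \<alpha>\<close>, and the integral over a unit window of the increment of \<open>\<psi>'\<close> for a constant displacement \<open>t\<close>
  is at most \<open>2 \<bar>t\<bar> sup \<bar>\<psi>'\<bar>\<close>, because its antiderivative is evaluated only near the two end points.\<close>
lemma mildly_nonconvex_of_smallness:
  fixes U \<psi> :: "real \<Rightarrow> real"
  assumes "\<alpha> > 0" "R > 0" "C2_line \<psi>" and supp: "\<forall>x. x \<notin> {-R..R} \<longrightarrow> \<psi> x = 0"
    and U: "\<forall>x. U x = \<alpha> * (\<bar>x\<bar>\<^sup>2 / 2) + \<psi> x" and "smallness \<alpha> \<psi> R"
  defines "m \<equiv> Linf_norm (deriv (deriv \<psi>))" and "\<beta> \<equiv> \<alpha> - 2 * Linf_norm (deriv \<psi>)"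
  shows "mildly_nonconvex_potential U (deriv U) m \<beta> (m - \<alpha>) R"
    and "\<And>x. \<bar>\<psi> x\<bar> \<le> Linf_norm \<psi>"
proof -
  define M1 where "M1 = Linf_norm (deriv \<psi>)"
  have d1: "(\<psi> has_real_derivative deriv \<psi> x) (at x)" for x
    using assms(3) unfolding C2_line_def by (simp add: DERIV_deriv_iff_real_differentiable)
  have d2: "(deriv \<psi> has_real_derivative deriv (deriv \<psi>) x) (at x)" for x
    using assms(3) unfolding C2_line_def by (simp add: DERIV_deriv_iff_real_differentiable)
  have s1: "deriv \<psi> x = 0" if "x \<notin> {-R..R}" for x using deriv_eq_0_outside supp that by blast
  have s2: "deriv (deriv \<psi>) x = 0" if "x \<notin> {-R..R}" for x using deriv_eq_0_outside s1 that by blast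
  show b0: "\<bar>\<psi> x\<bar> \<le> Linf_norm \<psi>" for x
    by (rule abs_le_Linf_norm_compact_support)
       (use d1 supp in \<open>auto intro: DERIV_continuous_on has_field_derivative_at_within\<close>)
  have b1: "\<bar>deriv \<psi> x\<bar> \<le> M1" for x unfolding M1_def
    by (rule abs_le_Linf_norm_compact_support)
       (use d2 s1 in \<open>auto intro: DERIV_continuous_on has_field_derivative_at_within\<close>)
  have b2: "\<bar>deriv (deriv \<psi>) x\<bar> \<le> m" for x unfolding m_def
    by (rule abs_le_Linf_norm_compact_support)
       (use s2 assms(3) in \<open>auto simp: C2_line_def\<close>)
  have "0 \<le> Linf_norm \<psi>" "0 \<le> Linf_norm (deriv \<psi>)"
    using b0[of 0] b1[of 0] unfolding M1_def by linarith+
  note c = smallness_consequences[OF assms(1,6) this, folded m_def \<beta>_def]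
  have dU: "(U has_real_derivative \<alpha> * x + deriv \<psi> x) (at x)" for x
  proof -
    have "U = (\<lambda>x. \<alpha> * (x\<^sup>2 / 2) + \<psi> x)" using U by auto
    then show ?thesis by (auto intro!: derivative_eq_intros d1)
  qed
  have U': "deriv U x = \<alpha> * x + deriv \<psi> x" for x using dU by (rule DERIV_imp_deriv)
  have mono2: "(deriv U y - deriv U x) \<le> (\<alpha> + m) * (y - x) \<and> - (m - \<alpha>) * (y - x) \<le> deriv U y - deriv U x"
    if "x \<le> y" for x y
  proof -
    have "\<bar>deriv \<psi> y - deriv \<psi> x\<bar> \<le> m * \<bar>y - x\<bar>"
      using field_differentiable_bound[of UNIV "deriv \<psi>" "deriv (deriv \<psi>)" m y x] d2 b2 by auto
    then have "\<bar>deriv \<psi> y - deriv \<psi> x\<bar> \<le> m * (y - x)" using that by simp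
    then show ?thesis unfolding U' abs_le_iff by (simp add: algebra_simps)
  qed
  show "mildly_nonconvex_potential U (deriv U) m \<beta> (m - \<alpha>) R"
  proof
    show "(U has_real_derivative deriv U x) (at x)" for x using dU U' by simp
    have lip': "\<bar>deriv U y - deriv U x\<bar> \<le> 2 * m * \<bar>y - x\<bar>" if "x \<le> y" for x y
    proof -
      have "(\<alpha> + m) * (y - x) \<le> 2 * m * (y - x)" using c that by (intro mult_right_mono) auto
      moreover have "- (2 * m) * (y - x) \<le> - (m - \<alpha>) * (y - x)" using c assms(1) that by (intro mult_right_mono) auto
      ultimately show ?thesis using mono2[OF that] that by (auto simp: abs_le_iff)
    qed
    then show "\<bar>deriv U y - deriv U x\<bar> \<le> 2 * m * \<bar>y - x\<bar>" for x y
      using lip'[of x y] lip'[of y x] by (cases "x \<le> y") (auto simp: abs_minus_commute)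
    show "- (m - \<alpha>) * t\<^sup>2 \<le> t * (deriv U (x + t) - deriv U x)" for x t
    proof (cases "0 \<le> t")
      case True
      then have "t * (- (m - \<alpha>) * t) \<le> t * (deriv U (x + t) - deriv U x)"
        using mono2[of x "x + t"] by (intro mult_left_mono) auto
      then show ?thesis by (simp add: power2_eq_square mult_ac)
    next
      case False
      then have "- t * (- (m - \<alpha>) * (- t)) \<le> - t * (deriv U x - deriv U (x + t))"
        using mono2[of "x + t" x] by (intro mult_left_mono) auto
      then show ?thesis by (simp add: power2_eq_square algebra_simps)
    qed
    have split: "t * (deriv U (x + t) - deriv U x) = \<alpha> * t\<^sup>2 + t * (deriv \<psi> (x + t) - deriv \<psi> x)" for x t
      unfolding U' by (simp add: power2_eq_square algebra_simps)
    show "\<beta> * t\<^sup>2 \<le> t * (deriv U (x + t) - deriv U x)" if "1 \<le> \<bar>t\<bar>" for x t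
    proof -
      have "\<bar>deriv \<psi> (x + t) - deriv \<psi> x\<bar> \<le> 2 * M1" using b1[of x] b1[of "x + t"] by linarith
      then have "- (t * (deriv \<psi> (x + t) - deriv \<psi> x)) \<le> \<bar>t\<bar> * (2 * M1)" by (rule neg_mult_le)
      also have "\<dots> \<le> t\<^sup>2 * (2 * M1)"
        using that b1[of 0] mult_right_mono[OF that, of "\<bar>t\<bar>"]
        by (intro mult_right_mono) (auto simp: power2_eq_square abs_mult[symmetric])
      finally show ?thesis unfolding split \<beta>_def M1_def[symmetric] by (simp add: algebra_simps)
    qed note far = this
    show "\<beta> * t\<^sup>2 \<le> t * (deriv U (x + t) - deriv U x)" if "R + 1 < \<bar>x\<bar>" for x t
    proof (cases "1 \<le> \<bar>t\<bar>")
      case False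
      then have "deriv \<psi> (x + t) = 0" "deriv \<psi> x = 0" using that by (auto intro!: s1)
      then show ?thesis unfolding split using c(2) by (simp add: mult_right_mono)
    qed (rule far)
    show "\<beta> * t\<^sup>2 \<le> t * (U (n + 1 + t) - U (n + t) - (U (n + 1) - U n))" for n t
    proof -
      have L: "\<bar>\<psi> (y + t) - \<psi> y\<bar> \<le> M1 * \<bar>t\<bar>" for y
        using field_differentiable_bound[of UNIV \<psi> "deriv \<psi>" M1 "y + t" y] d1 b1 by auto
      let ?d = "(\<psi> (n + 1 + t) - \<psi> (n + 1)) - (\<psi> (n + t) - \<psi> n)"
      have "\<bar>?d\<bar> \<le> 2 * M1 * \<bar>t\<bar>" using L[of n] L[of "n + 1"] by linarith
      then have "- (t * ?d) \<le> \<bar>t\<bar> * (2 * M1 * \<bar>t\<bar>)" by (rule neg_mult_le)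
      also have "\<dots> = 2 * M1 * t\<^sup>2" by (simp add: power2_eq_square abs_mult_self_eq mult_ac)
      finally have "\<beta> * t\<^sup>2 \<le> \<alpha> * t\<^sup>2 + t * ?d" unfolding \<beta>_def M1_def[symmetric] by (simp add: algebra_simps)
      also have "\<dots> = t * (U (n + 1 + t) - U (n + t) - (U (n + 1) - U n))"
        unfolding U[rule_format] by (simp add: power2_eq_square field_simps)
      finally show ?thesis .
    qed
    show "\<bar>deriv U x\<bar> \<le> 3 / 25" if "\<bar>x\<bar> \<le> R + 2" for x
    proof -
      have "\<bar>\<alpha> * x\<bar> \<le> \<alpha> * (R + 2)" using that assms(1) by (simp add: abs_mult mult_left_mono)
      moreover have "2 * M1 < \<alpha>" using c(1) unfolding \<beta>_def M1_def by simp
      ultimately show ?thesis using b1[of x] c unfolding U' by linarith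
    qed
    show "0 < m" "160 * m\<^sup>2 \<le> \<beta>" "m < 1 / 160" "0 < \<beta>" "\<beta> < 1 / 160" "0 \<le> m - \<alpha>" "160 * (m - \<alpha>) \<le> \<beta>"
      using c assms(1) by auto
  qed
qed

section \<open>Integration over the plane\<close>

abbreviation pt :: "real \<Rightarrow> real \<Rightarrow> real^2" where
  "pt x v \<equiv> vector [x, v]"

lemma pt_decompose: "pt x v = x *\<^sub>R axis 1 1 + v *\<^sub>R axis 2 1"
  by (simp add: vec_eq_iff forall_2 axis_def)

lemma continuous_on_pt: "continuous_on S f \<Longrightarrow> continuous_on S g \<Longrightarrow> continuous_on S (\<lambda>s. pt (f s) (g s))"
  unfolding pt_decompose by (intro continuous_intros)

text \<open>The velocity is placed first in the pair so that Fubini's theorem for the outer first component integrates over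
  \<open>x\<close> at fixed \<open>v\<close>.\<close>
lemma lborel_plane: "distr lborel borel (\<lambda>p. pt (snd p) (fst p)) = (lborel :: (real^2) measure)"
proof (rule lborel_eqI[symmetric])
  have [measurable]: "(\<lambda>p. pt (snd p) (fst p)) \<in> borel_measurable borel"
    by (intro borel_measurable_continuous_onI continuous_on_pt continuous_intros)
  fix l u :: "real^2"
  assume le: "\<And>b. b \<in> Basis \<Longrightarrow> l \<bullet> b \<le> u \<bullet> b"
  have l: "l $ 1 \<le> u $ 1" "l $ 2 \<le> u $ 2"
    using le[of "axis 1 1"] le[of "axis 2 1"] by (auto simp: inner_axis)
  have e: "(\<lambda>p. pt (snd p) (fst p)) -` box l u = {l $ 2<..<u $ 2} \<times> {l $ 1<..<u $ 1}"
    by (auto simp: mem_box_cart forall_2)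
  have B: "(Basis :: (real^2) set) = {axis 1 1, axis 2 1}"
    by (auto simp: Basis_vec_def UNIV_2)
  have "emeasure (distr lborel borel (\<lambda>p. pt (snd p) (fst p))) (box l u) =
      emeasure (lborel \<Otimes>\<^sub>M lborel) ({l $ 2<..<u $ 2} \<times> {l $ 1<..<u $ 1})"
    by (subst emeasure_distr) (simp_all add: e lborel_prod)
  also have "\<dots> = ennreal (u $ 2 - l $ 2) * ennreal (u $ 1 - l $ 1)"
    by (subst lborel.emeasure_pair_measure_Times) (simp_all add: l)
  also have "\<dots> = ennreal ((u $ 1 - l $ 1) * (u $ 2 - l $ 2))"
    using l by (simp add: ennreal_mult[symmetric] mult.commute)
  also have "\<dots> = (\<Prod>b\<in>Basis. (u - l) \<bullet> b)"
    by (simp add: B axis_eq_axis inner_axis)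
  finally show "emeasure (distr lborel borel (\<lambda>p. pt (snd p) (fst p))) (box l u) = (\<Prod>b\<in>Basis. (u - l) \<bullet> b)" .
qed simp

lemma integrable_plane_iff:
  fixes f :: "real^2 \<Rightarrow> real"
  assumes [measurable]: "f \<in> borel_measurable borel"
  shows "integrable lborel f \<longleftrightarrow> integrable (lborel \<Otimes>\<^sub>M lborel) (\<lambda>p. f (pt (snd p) (fst p)))"
    and "integral\<^sup>L lborel f = integral\<^sup>L (lborel \<Otimes>\<^sub>M lborel) (\<lambda>p. f (pt (snd p) (fst p)))"
proof -
  have [measurable]: "(\<lambda>p. pt (snd p) (fst p)) \<in> borel_measurable borel"
    by (intro borel_measurable_continuous_onI continuous_on_pt continuous_intros)
  show "integrable lborel f \<longleftrightarrow> integrable (lborel \<Otimes>\<^sub>M lborel) (\<lambda>p. f (pt (snd p) (fst p)))"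
    by (subst lborel_plane[symmetric], subst integrable_distr_eq) (simp_all add: lborel_prod)
  show "integral\<^sup>L lborel f = integral\<^sup>L (lborel \<Otimes>\<^sub>M lborel) (\<lambda>p. f (pt (snd p) (fst p)))"
    by (subst lborel_plane[symmetric], subst integral_distr) (simp_all add: lborel_prod)
qed

lemma integral_plane_nonneg:
  fixes f :: "real^2 \<Rightarrow> real"
  assumes f: "integrable lborel f"
    and sec: "\<And>v. integrable lborel (\<lambda>x. f (pt x v)) \<Longrightarrow> 0 \<le> (LINT x|lborel. f (pt x v))"
  shows "0 \<le> integral\<^sup>L lborel f"
proof -
  have [measurable]: "f \<in> borel_measurable borel" using f by auto
  have i: "integrable (lborel \<Otimes>\<^sub>M lborel) (\<lambda>p. f (pt (snd p) (fst p)))"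
    using f integrable_plane_iff(1) by simp
  have "integral\<^sup>L lborel f = (LINT v|lborel. LINT x|lborel. f (pt x v))"
    using lborel_pair.integral_fst'[OF i] integrable_plane_iff(2)[of f] by simp
  moreover have "AE v in lborel. 0 \<le> (LINT x|lborel. f (pt x v))"
    using lborel_pair.AE_integrable_fst'[OF i] by eventually_elim (simp add: sec)
  ultimately show ?thesis using integral_nonneg_AE by simp
qed

lemma integral_nonneg_of_windows:
  fixes p :: "real \<Rightarrow> real"
  assumes c: "continuous_on UNIV p" and i: "integrable lborel p"
    and win: "\<And>n. 0 \<le> integral {n..n + 1} p"
  shows "0 \<le> integral\<^sup>L lborel p"
proof -
  have int: "p integrable_on {a..b}" for a b
    using c by (intro integrable_continuous_real) (auto intro: continuous_on_subset)
  have nn: "0 \<le> integral {- real N..real N} p" for N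
  proof (induction N)
    case (Suc N)
    have "integral {- real (Suc N)..real (Suc N)} p =
        integral {- real (Suc N)..- real (Suc N) + 1} p + integral {- real (Suc N) + 1..real (Suc N)} p"
      by (rule Henstock_Kurzweil_Integration.integral_combine[symmetric]) (use int in auto)
    also have "integral {- real (Suc N) + 1..real (Suc N)} p =
        integral {- real (Suc N) + 1..real N} p + integral {real N..real (Suc N)} p"
      by (rule Henstock_Kurzweil_Integration.integral_combine[symmetric]) (use int in auto)
    finally show ?case
      using Suc win[of "- real (Suc N)"] win[of "real N"] by (simp add: add.commute)
  qed simp
  have "(\<lambda>N. LINT x|lborel. indicator {- real N..real N} x * p x) \<longlonglongrightarrow> integral\<^sup>L lborel p"
  proof (rule integral_dominated_convergence)
    show "integrable lborel (\<lambda>x. \<bar>p x\<bar>)" using i by auto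
    show "AE x in lborel. (\<lambda>N. indicator {- real N..real N} x * p x) \<longlonglongrightarrow> p x"
    proof (rule AE_I2)
      fix x
      have "\<forall>\<^sub>F N in sequentially. \<bar>x\<bar> \<le> real N"
        using eventually_ge_at_top[of "nat \<lceil>\<bar>x\<bar>\<rceil>"] by eventually_elim linarith
      then have "\<forall>\<^sub>F N in sequentially. indicator {- real N..real N} x * p x = p x"
        by eventually_elim (auto simp: indicator_def)
      then show "(\<lambda>N. indicator {- real N..real N} x * p x) \<longlonglongrightarrow> p x"
        by (rule tendsto_eventually)
    qed
  qed (use i in \<open>auto simp: indicator_def\<close>)
  moreover have "0 \<le> (LINT x|lborel. indicator {- real N..real N} x * p x)" for N
  proof -
    have "set_integrable lborel {- real N..real N} p"
      using i unfolding set_integrable_def by (intro integrable_mult_indicator) auto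
    from set_borel_integral_eq_integral(2)[OF this] nn[of N] show ?thesis
      by (simp add: set_lebesgue_integral_def)
  qed
  ultimately show ?thesis by (intro LIMSEQ_le_const) auto
qed

lemma integrable_power_gaussian:
  fixes c :: real
  assumes "0 < c"
  shows "integrable lborel (\<lambda>x. x ^ k * exp (- c * x\<^sup>2))"
proof -
  define s where "s = sqrt (1 / (2 * c))"
  have s: "0 < s" "s\<^sup>2 = 1 / (2 * c)" using assms by (auto simp: s_def)
  have "integrable lborel (\<lambda>x. sqrt (2 * pi * s\<^sup>2) * (normal_density 0 s x * (x - 0) ^ k))"
    using integrable_normal_moment[OF s(1), of 0 k] by (rule integrable_mult_right)
  moreover have "sqrt (2 * pi * s\<^sup>2) * (normal_density 0 s x * (x - 0) ^ k) = x ^ k * exp (- c * x\<^sup>2)" for x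
    using s(1) assms unfolding normal_density_def s(2) by (simp add: field_simps)
  ultimately show ?thesis by (simp only:)
qed

lemma integrable_plane_product:
  fixes f g :: "real \<Rightarrow> real"
  assumes f: "integrable lborel f" and g: "integrable lborel g"
  shows "integrable lborel (\<lambda>z::real^2. f (z $ 1) * g (z $ 2))"
proof -
  have [measurable]: "f \<in> borel_measurable borel" "g \<in> borel_measurable borel" using f g by auto
  have [measurable]: "(\<lambda>z::real^2. z $ i) \<in> borel_measurable borel" for i
    by (intro borel_measurable_continuous_onI continuous_intros)
  have "integrable (lborel \<Otimes>\<^sub>M lborel) (\<lambda>p. f (snd p) * g (fst p))"
    by (rule lborel_pair.Fubini_integrable)
       (use f g in \<open>auto simp: abs_mult intro!: integrable_mult_left integrable_mult_right\<close>)
  then show ?thesis by (subst integrable_plane_iff(1)) auto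
qed

section \<open>The metric and the dissipation\<close>

text \<open>With this choice of the entries (\<open>a = b\<close>) the position and velocity displacements \<open>\<xi>\<close> and \<open>\<eta>\<close> enter the drift
  term only through \<open>\<eta>\<^sup>2\<close> and the product of \<open>h = \<xi> + 2 \<eta>\<close> with the increment of \<open>U'\<close>.\<close>
definition hypo_matrix :: "real^2^2" where
  "hypo_matrix = vector [vector [1, 1], vector [1, 2]]"

lemma hypo_matrix_entry [simp]:
  "hypo_matrix $ 1 $ 1 = 1" "hypo_matrix $ 1 $ 2 = 1" "hypo_matrix $ 2 $ 1 = 1" "hypo_matrix $ 2 $ 2 = 2"
  by (simp_all add: hypo_matrix_def)

lemma inner_hypo_matrix:
  "inner_A hypo_matrix z w = z $ 1 * (w $ 1 + w $ 2) + z $ 2 * (w $ 1 + 2 * w $ 2)"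
  by (simp add: inner_A_def inner_vec_def sum_2 matrix_vector_mult_def)

lemma sym_pos_def_hypo_matrix: "sym_pos_def hypo_matrix"
  unfolding sym_pos_def_def
proof (intro conjI allI impI)
  show "transpose hypo_matrix = hypo_matrix"
    by (simp add: vec_eq_iff forall_2 transpose_def)
  fix z :: "real^2" assume "z \<noteq> 0"
  then have "z $ 1 \<noteq> 0 \<or> z $ 2 \<noteq> 0" by (simp add: vec_eq_iff forall_2)
  then have "0 < (z $ 1 + z $ 2)\<^sup>2 + (z $ 2)\<^sup>2"
    by (cases "z $ 2 = 0") (auto intro: add_nonneg_pos)
  then show "0 < z \<bullet> (hypo_matrix *v z)"
    using inner_hypo_matrix[of z z] unfolding inner_A_def by (simp add: power2_eq_square algebra_simps)
qed

lemma grad_eq_transport_map: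
  "grad \<phi> z $ 1 = transport_map hypo_matrix \<phi> z $ 1 + transport_map hypo_matrix \<phi> z $ 2"
  "grad \<phi> z $ 2 = transport_map hypo_matrix \<phi> z $ 1 + 2 * transport_map hypo_matrix \<phi> z $ 2"
proof -
  have "invertible hypo_matrix" by (simp add: invertible_det_nz det_2)
  then have "hypo_matrix ** matrix_inv hypo_matrix = mat 1"
    unfolding invertible_def matrix_inv_def by (rule someI2_ex) simp
  then have "hypo_matrix *v transport_map hypo_matrix \<phi> z = grad \<phi> z"
    by (simp add: transport_map_def matrix_vector_mul_assoc)
  from this[symmetric] show "grad \<phi> z $ 1 = transport_map hypo_matrix \<phi> z $ 1 + transport_map hypo_matrix \<phi> z $ 2"
    "grad \<phi> z $ 2 = transport_map hypo_matrix \<phi> z $ 1 + 2 * transport_map hypo_matrix \<phi> z $ 2"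
    by (simp_all add: matrix_vector_mult_def sum_2)
qed

lemma sym_pos_def_2:
  assumes "sym_pos_def M"
  shows "M $ 2 $ 1 = M $ 1 $ 2" "0 < M $ 1 $ 1" "0 < M $ 2 $ 2" "0 < det M"
proof -
  have t: "transpose M = M" and pos: "\<And>z. z \<noteq> 0 \<Longrightarrow> 0 < z \<bullet> (M *v z)"
    using assms unfolding sym_pos_def_def by auto
  have "transpose M $ 1 $ 2 = M $ 1 $ 2" using t by simp
  then show s: "M $ 2 $ 1 = M $ 1 $ 2" by (simp add: transpose_def)
  have q: "pt x v \<bullet> (M *v pt x v) = M $ 1 $ 1 * x\<^sup>2 + 2 * M $ 1 $ 2 * x * v + M $ 2 $ 2 * v\<^sup>2" for x v
    using s by (simp add: inner_vec_def sum_2 matrix_vector_mult_def power2_eq_square algebra_simps)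
  have nz: "pt x v \<noteq> 0" if "x \<noteq> 0 \<or> v \<noteq> 0" for x v
    using that by (auto simp: vec_eq_iff forall_2)
  show a: "0 < M $ 1 $ 1" using pos[OF nz, of 1 0] by (simp add: q)
  show c: "0 < M $ 2 $ 2" using pos[OF nz, of 0 1] by (simp add: q)
  have "0 < M $ 2 $ 2 * det M"
    using pos[OF nz, of "M $ 2 $ 2" "- M $ 1 $ 2"] c s unfolding q
    by (simp add: det_2 power2_eq_square algebra_simps)
  then show "0 < det M" using c by (simp add: zero_less_mult_iff)
qed

text \<open>The second integrand of \<open>\<J>\<close> for \<open>b = 1\<close> and \<open>c = 2\<close>, as a function of \<open>M = \<nabla>\<^sup>2\<phi>\<close>. With \<open>k = (M - A) e\<^sub>2\<close>, the
  gradient of \<open>\<partial>\<^sub>v\<phi> - x - 2 v\<close>, it equals the inner product of \<open>k\<close> with the inverse of \<open>M\<close> applied to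
  \<open>k\<close>.\<close>
definition dissipation :: "real^2^2 \<Rightarrow> real" where
  "dissipation M = inverse (M $ 2 $ 2) * ((M $ 2 $ 2 - 2)\<^sup>2 +
     (1 * (M $ 2 $ 2 - 2) - 2 * (M $ 1 $ 2 - 1))\<^sup>2 / det M)"

lemma dissipation_nonneg: "sym_pos_def M \<Longrightarrow> 0 \<le> dissipation M"
  unfolding dissipation_def using sym_pos_def_2[of M]
  by (intro mult_nonneg_nonneg add_nonneg_nonneg divide_nonneg_nonneg) auto

text \<open>The Cauchy--Schwarz inequality between the quadratic forms of \<open>M\<close> and of its inverse, applied to \<open>e\<^sub>1\<close> and
  \<open>(M - A) e\<^sub>2\<close>. It is the step where a term that comes from diffusion in \<open>v\<close> alone
  controls a derivative in \<open>x\<close>: by symmetry of the Hessian, \<open>\<partial>\<^sub>v\<partial>\<^sub>x\<phi>\<close> is the \<open>x\<close>-derivative of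
  \<open>\<partial>\<^sub>v\<phi>\<close>.\<close>
lemma off_diagonal_le_dissipation:
  assumes "sym_pos_def M"
  shows "(M $ 2 $ 1 - 1)\<^sup>2 \<le> dissipation M * M $ 1 $ 1"
proof -
  note M = sym_pos_def_2[OF assms]
  define x y d where "x = M $ 1 $ 2" and "y = M $ 2 $ 2" and "d = det M"
  define p e where "p = y - 2" and "e = p - 2 * (x - 1)"
  have pos: "0 < y" "0 < d" using M by (auto simp: y_def d_def)
  have M11: "M $ 1 $ 1 = (d + x\<^sup>2) / y"
    using M unfolding d_def x_def y_def det_2 by (simp add: power2_eq_square field_simps)
  have "(y * (x - 1))\<^sup>2 = (p * x - e)\<^sup>2" unfolding p_def e_def by (simp add: algebra_simps)
  also have "\<dots> \<le> (p * x - e)\<^sup>2 + (p * d + e * x)\<^sup>2 / d" using pos by simp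
  also have "\<dots> = (p\<^sup>2 + e\<^sup>2 / d) * (d + x\<^sup>2)"
    using pos by (simp add: field_simps power2_eq_square)
  finally have "(y * (x - 1))\<^sup>2 / y\<^sup>2 \<le> (p\<^sup>2 + e\<^sup>2 / d) * (d + x\<^sup>2) / y\<^sup>2"
    by (rule divide_right_mono) simp
  then have "(x - 1)\<^sup>2 \<le> (p\<^sup>2 + e\<^sup>2 / d) * (d + x\<^sup>2) / y\<^sup>2"
    using pos by (simp add: power_mult_distrib)
  also have "\<dots> = dissipation M * M $ 1 $ 1"
    unfolding M11 dissipation_def x_def[symmetric] y_def[symmetric] d_def[symmetric] p_def[symmetric]
    by (simp add: e_def power2_eq_square field_simps)
  finally show ?thesis using M(1) unfolding x_def by simp
qed

lemma grad_has_derivative_along_x: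
  assumes "C2_plane \<phi>"
  shows "((\<lambda>x. grad \<phi> (pt x v) $ i) has_real_derivative hess \<phi> (pt x v) $ i $ 1) (at x)"
proof -
  let ?H = "hess \<phi> (pt x v)"
  have "(grad \<phi> has_derivative (\<lambda>k. ?H *v k)) (at (pt x v))"
    using assms unfolding C2_plane_def hess_def by (simp add: jacobian_works[symmetric])
  moreover have "((\<lambda>x. pt x v) has_derivative (\<lambda>k. k *\<^sub>R axis 1 1)) (at x)"
    unfolding pt_decompose by (auto intro!: derivative_eq_intros)
  ultimately have "((\<lambda>x. grad \<phi> (pt x v)) has_derivative (\<lambda>k. ?H *v (k *\<^sub>R axis 1 1))) (at x)"
    by (rule has_derivative_compose[rotated])
  then have "((\<lambda>x. grad \<phi> (pt x v) $ i) has_derivative (\<lambda>k. (?H *v (k *\<^sub>R axis 1 1)) $ i)) (at x)"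
    by (rule bounded_linear.has_derivative[OF bounded_linear_vec_nth])
  moreover have "(?H *v (k *\<^sub>R axis 1 1)) $ i = ?H $ i $ 1 * k" for k
    by (simp add: matrix_vector_mult_def sum_2 axis_def)
  ultimately show ?thesis by (simp add: has_field_derivative_def)
qed

lemma C2_planeD:
  assumes "C2_plane \<phi>"
  shows "continuous_on UNIV (grad \<phi>)" "continuous_on UNIV (hess \<phi>)"
  using assms unfolding C2_plane_def C1_plane_def by auto

lemma continuous_dissipation:
  assumes "C2_plane \<phi>" "\<And>z. sym_pos_def (hess \<phi> z)"
  shows "continuous_on UNIV (\<lambda>z. dissipation (hess \<phi> z))"
proof -
  have c: "continuous_on UNIV (\<lambda>z. hess \<phi> z $ i $ j)" for i j
    using C2_planeD(2)[OF assms(1)] by (intro continuous_intros)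
  have det: "continuous_on UNIV (\<lambda>z. det (hess \<phi> z))"
    unfolding det_2 by (intro continuous_on_diff continuous_on_mult c)
  have nz: "\<forall>z\<in>UNIV. det (hess \<phi> z) \<noteq> 0" "\<forall>z\<in>UNIV. hess \<phi> z $ 2 $ 2 \<noteq> 0"
    using sym_pos_def_2(3,4)[OF assms(2)] by (metis less_irrefl)+
  show ?thesis unfolding dissipation_def
    by (intro continuous_on_mult continuous_on_inverse continuous_on_add continuous_on_power
        continuous_on_divide continuous_on_diff continuous_on_const c det nz)
qed

context mildly_nonconvex_potential
begin

lemma drift_inner:
  fixes T z :: "real^2"
  assumes "\<eta> = T $ 2 - z $ 2" "h = (T $ 1 - z $ 1) + 2 * \<eta>"
  shows "inner_A hypo_matrix (drift U T - drift U z) (T - z) =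
    - (\<eta>\<^sup>2 + h * (dU (z $ 1 + (h - 2 * \<eta>)) - dU (z $ 1)))"
  unfolding inner_hypo_matrix drift_def deriv_U assms by (simp add: power2_eq_square algebra_simps)

text \<open>The inequality on a line of constant velocity, where the stationary density is proportional to \<open>exp (- U)\<close>.\<close>
lemma section_nonneg:
  assumes \<phi>: "C2_plane \<phi>" "\<And>z. sym_pos_def (hess \<phi> z)" and k: "0 \<le> k"
  defines "T \<equiv> transport_map hypo_matrix \<phi>"
  defines "P \<equiv> \<lambda>z. dissipation (hess \<phi> z) - inner_A hypo_matrix (drift U (T z) - drift U z) (T z - z)
      - \<beta> / 160 * inner_A hypo_matrix (z - T z) (z - T z)"
  assumes int: "integrable lborel (\<lambda>x. P (pt x v) * (exp (- U x) * k))"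
    and c: "continuous_on UNIV (\<lambda>x. P (pt x v) * (exp (- U x) * k))"
  shows "0 \<le> (LINT x|lborel. P (pt x v) * (exp (- U x) * k))"
proof (rule integral_nonneg_of_windows[OF c int])
  fix n :: real
  define \<eta> where "\<eta> = (\<lambda>x. T (pt x v) $ 2 - v)"
  define h where "h = (\<lambda>x. (T (pt x v) $ 1 - x) + 2 * \<eta> x)"
  define Q where "Q = (\<lambda>x. dissipation (hess \<phi> (pt x v)))"
  define W where "W = (\<lambda>x. (49 / 100 * (\<eta> x)\<^sup>2 + (h x * (dU (x + h x) - dU x) - \<beta> / 16 * (h x)\<^sup>2) + Q x) * exp (- U x))"
  have cg: "continuous_on UNIV (\<lambda>x. grad \<phi> (pt x v) $ i)" for i
    by (intro continuous_on_compose2[OF C2_planeD(1)[OF \<phi>(1)]] continuous_intros continuous_on_pt) auto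
  have g: "h = (\<lambda>x. grad \<phi> (pt x v) $ 2 - x - 2 * v)" "\<eta> = (\<lambda>x. grad \<phi> (pt x v) $ 2 - grad \<phi> (pt x v) $ 1 - v)"
    unfolding h_def \<eta>_def T_def grad_eq_transport_map by (auto simp: algebra_simps)
  have c\<eta>: "continuous_on UNIV \<eta>" unfolding g by (intro continuous_intros cg)
  have ch: "continuous_on UNIV h" unfolding g by (intro continuous_intros cg)
  have cQ: "continuous_on UNIV Q" unfolding Q_def
    by (rule continuous_on_compose2[OF continuous_dissipation[OF \<phi>]]) (auto intro!: continuous_on_pt continuous_intros)
  have "0 \<le> integral {n..n + 1} W"
    unfolding W_def
  proof (rule window_nonneg[where v = v])
    show "(h has_real_derivative hess \<phi> (pt x v) $ 2 $ 1 - 1) (at x)" for x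
      unfolding g by (auto intro!: derivative_eq_intros grad_has_derivative_along_x[OF \<phi>(1)])
    show "((\<lambda>x. grad \<phi> (pt x v) $ 1) has_real_derivative hess \<phi> (pt x v) $ 1 $ 1) (at x)" for x
      by (rule grad_has_derivative_along_x[OF \<phi>(1)])
    show "0 \<le> Q x" "(hess \<phi> (pt x v) $ 2 $ 1 - 1)\<^sup>2 \<le> Q x * hess \<phi> (pt x v) $ 1 $ 1"
      "0 \<le> hess \<phi> (pt x v) $ 1 $ 1" for x
      unfolding Q_def using dissipation_nonneg off_diagonal_le_dissipation sym_pos_def_2(2) \<phi>(2) by (auto intro: less_imp_le)
    show "grad \<phi> (pt x v) $ 1 = x + v + h x - \<eta> x" for x unfolding g by simp
  qed fact+
  then have "0 \<le> k * integral {n..n + 1} W" using k by simp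
  also have "\<dots> = integral {n..n + 1} (\<lambda>x. k * W x)" by simp
  also have "\<dots> \<le> integral {n..n + 1} (\<lambda>x. P (pt x v) * (exp (- U x) * k))"
  proof (rule integral_le)
    show "(\<lambda>x. k * W x) integrable_on {n..n + 1}"
      unfolding W_def
      by (intro integrable_continuous_real continuous_intros continuous_dU_compose continuous_U)
         (use c\<eta> ch cQ in \<open>auto intro: continuous_on_subset\<close>)
    show "(\<lambda>x. P (pt x v) * (exp (- U x) * k)) integrable_on {n..n + 1}"
      using c by (intro integrable_continuous_real) (auto intro: continuous_on_subset)
    fix x assume "x \<in> {n..n + 1}"
    have "inner_A hypo_matrix (pt x v - T (pt x v)) (pt x v - T (pt x v)) = (h x)\<^sup>2 - 2 * h x * \<eta> x + 2 * (\<eta> x)\<^sup>2"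
      unfolding inner_hypo_matrix h_def \<eta>_def by (simp add: power2_eq_square algebra_simps)
    moreover have "inner_A hypo_matrix (drift U (T (pt x v)) - drift U (pt x v)) (T (pt x v) - pt x v) =
        - ((\<eta> x)\<^sup>2 + h x * (dU (x + (h x - 2 * \<eta> x)) - dU x))"
      using drift_inner[of "\<eta> x" "T (pt x v)" "pt x v" "h x"] by (simp add: \<eta>_def h_def)
    ultimately have "P (pt x v) = (\<eta> x)\<^sup>2 + h x * (dU (x + (h x - 2 * \<eta> x)) - dU x)
        - \<beta> / 160 * ((h x)\<^sup>2 - 2 * h x * \<eta> x + 2 * (\<eta> x)\<^sup>2) + Q x"
      unfolding P_def Q_def by simp
    then have "49 / 100 * (\<eta> x)\<^sup>2 + (h x * (dU (x + h x) - dU x) - \<beta> / 16 * (h x)\<^sup>2) + Q x \<le> P (pt x v)"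
      using pointwise_reduction[where \<eta> = "\<eta> x" and h = "h x" and x = x] by linarith
    then have "W x \<le> P (pt x v) * exp (- U x)" unfolding W_def by (intro mult_right_mono) auto
    then show "k * W x \<le> P (pt x v) * (exp (- U x) * k)" using k
      using mult_left_mono[of "W x" "P (pt x v) * exp (- U x)" k] by (simp add: mult_ac)
  qed
  finally show "0 \<le> integral {n..n + 1} (\<lambda>x. P (pt x v) * (exp (- U x) * k))" .
qed

end

section \<open>Integrability and the stationary density\<close>

lemma f_inf_nonneg: "0 \<le> f_inf U z"
  unfolding f_inf_def by (intro divide_nonneg_nonneg mult_nonneg_nonneg integral_nonneg) auto

lemma f_inf_pt:
  "f_inf U (pt x v) = exp (- U x) * (exp (- v\<^sup>2 / 2) / (sqrt (2 * pi) * (LINT y|lborel. exp (- U y))))"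
proof -
  have "exp (- U x - v\<^sup>2 / 2) = exp (- U x) * exp (- v\<^sup>2 / 2)"
    using exp_add[of "- U x" "- v\<^sup>2 / 2"] by simp
  then show ?thesis unfolding f_inf_def by simp
qed

lemma continuous_f_inf:
  assumes "continuous_on UNIV U"
  shows "continuous_on UNIV (f_inf U)"
proof -
  have "continuous_on UNIV (\<lambda>z::real^2. U (z $ 1))"
    by (rule continuous_on_compose2[OF assms]) (auto intro!: continuous_intros)
  then have "continuous_on UNIV (\<lambda>z::real^2. exp (- U (z $ 1) - \<bar>z $ 2\<bar>\<^sup>2 * (1 / 2))
      * inverse (sqrt (2 * pi) * (LINT y|lborel. exp (- U y))))"
    by (intro continuous_on_mult continuous_on_exp continuous_on_diff continuous_on_minus continuous_on_power
        continuous_on_rabs continuous_on_component continuous_on_const continuous_on_id)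
  moreover have "f_inf U = (\<lambda>z. exp (- U (z $ 1) - \<bar>z $ 2\<bar>\<^sup>2 * (1 / 2))
      * inverse (sqrt (2 * pi) * (LINT y|lborel. exp (- U y))))"
    by (rule ext) (simp add: f_inf_def inverse_eq_divide)
  ultimately show ?thesis by simp
qed

lemma norm_sq_2: "(norm (z::real^2))\<^sup>2 = (z $ 1)\<^sup>2 + (z $ 2)\<^sup>2"
  by (simp add: norm_vec_def L2_set_def sum_2)

lemma integrable_second_moment_f_inf:
  assumes "\<alpha> > 0" and U: "\<And>x. U x = \<alpha> * (\<bar>x\<bar>\<^sup>2 / 2) + \<psi> x" and C: "\<And>x. \<bar>\<psi> x\<bar> \<le> C"
    and cont: "continuous_on UNIV U"
  shows "integrable lborel (\<lambda>z. (norm z)\<^sup>2 * f_inf U z)"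
proof -
  define N where "N = sqrt (2 * pi) * (LINT y|lborel. exp (- U y))"
  have N: "0 \<le> N" unfolding N_def by (intro mult_nonneg_nonneg integral_nonneg) auto
  let ?g = "\<lambda>k c x. x ^ k * exp (- c * x\<^sup>2) :: real"
  let ?b = "\<lambda>z::real^2. exp C / N * (?g 2 (\<alpha> / 2) (z $ 1) * ?g 0 (1 / 2) (z $ 2) + ?g 0 (\<alpha> / 2) (z $ 1) * ?g 2 (1 / 2) (z $ 2))"
  have "integrable lborel ?b"
    by (intro integrable_mult_right Bochner_Integration.integrable_add integrable_plane_product integrable_power_gaussian)
       (use assms(1) in auto)
  then show ?thesis
  proof (rule Bochner_Integration.integrable_bound)
    show "(\<lambda>z. (norm z)\<^sup>2 * f_inf U z) \<in> borel_measurable lborel"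
      using borel_measurable_continuous_onI[OF continuous_f_inf[OF cont]] by measurable
    show "AE z in lborel. norm ((norm z)\<^sup>2 * f_inf U z) \<le> norm (?b z)"
    proof (rule AE_I2)
      fix z :: "real^2"
      have "exp (- U (z $ 1) - \<bar>z $ 2\<bar>\<^sup>2 / 2) \<le> exp (C + (- (\<alpha> / 2) * (z $ 1)\<^sup>2 + - (1 / 2) * (z $ 2)\<^sup>2))"
        using C[of "z $ 1"] unfolding U by (simp add: abs_le_iff)
      also have "\<dots> = exp C * (exp (- (\<alpha> / 2) * (z $ 1)\<^sup>2) * exp (- (1 / 2) * (z $ 2)\<^sup>2))"
        unfolding exp_add ..
      finally have "f_inf U z \<le> exp C * (exp (- (\<alpha> / 2) * (z $ 1)\<^sup>2) * exp (- (1 / 2) * (z $ 2)\<^sup>2)) / N"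
        unfolding f_inf_def N_def[symmetric] using N by (rule divide_right_mono)
      then have "(norm z)\<^sup>2 * f_inf U z \<le>
          (norm z)\<^sup>2 * (exp C * (exp (- (\<alpha> / 2) * (z $ 1)\<^sup>2) * exp (- (1 / 2) * (z $ 2)\<^sup>2)) / N)"
        by (rule mult_left_mono) simp
      also have "\<dots> = ?b z" unfolding norm_sq_2 by (simp add: algebra_simps add_divide_distrib)
      finally show "norm ((norm z)\<^sup>2 * f_inf U z) \<le> norm (?b z)"
        using f_inf_nonneg[of U z] N by simp
    qed
  qed
qed

lemma inner_hypo_matrix_le: "\<bar>inner_A hypo_matrix d d\<bar> \<le> 5 * (norm d)\<^sup>2"
proof -
  have "inner_A hypo_matrix d d = (d $ 1)\<^sup>2 + 2 * (d $ 1 * d $ 2) + 2 * (d $ 2)\<^sup>2"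
    unfolding inner_hypo_matrix by (simp add: power2_eq_square algebra_simps)
  moreover have "2 * (d $ 1 * d $ 2) \<le> (d $ 1)\<^sup>2 + (d $ 2)\<^sup>2" "- (2 * (d $ 1 * d $ 2)) \<le> (d $ 1)\<^sup>2 + (d $ 2)\<^sup>2"
    using zero_le_power2[of "d $ 1 - d $ 2"] zero_le_power2[of "d $ 1 + d $ 2"]
    by (simp_all add: power2_sum power2_diff)
  ultimately show ?thesis
    using zero_le_power2[of "d $ 1"] zero_le_power2[of "d $ 2"] unfolding norm_sq_2 abs_le_iff by argo
qed

lemma (in mildly_nonconvex_potential) drift_inner_le:
  fixes T z :: "real^2"
  shows "\<bar>inner_A hypo_matrix (drift U T - drift U z) (T - z)\<bar> \<le> 4 * (norm (T - z))\<^sup>2"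
proof -
  define \<xi> \<eta> where "\<xi> = T $ 1 - z $ 1" and "\<eta> = T $ 2 - z $ 2"
  let ?D = "dU (z $ 1 + \<xi>) - dU (z $ 1)"
  have D: "\<bar>?D\<bar> \<le> \<bar>\<xi>\<bar>"
  proof -
    have "2 * m * \<bar>\<xi>\<bar> \<le> 1 * \<bar>\<xi>\<bar>" using m by (intro mult_right_mono) auto
    then show ?thesis using lip[of "z $ 1 + \<xi>" "z $ 1"] by simp
  qed
  have "\<bar>(\<xi> + 2 * \<eta>) * ?D\<bar> \<le> (\<bar>\<xi>\<bar> + 2 * \<bar>\<eta>\<bar>) * \<bar>\<xi>\<bar>"
    unfolding abs_mult using D by (intro mult_mono) auto
  also have "\<dots> \<le> 2 * \<xi>\<^sup>2 + \<eta>\<^sup>2"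
    using zero_le_power2[of "\<bar>\<xi>\<bar> - \<bar>\<eta>\<bar>"] by (simp add: power2_diff power2_eq_square algebra_simps abs_mult_self_eq)
  finally have "\<bar>\<eta>\<^sup>2 + (\<xi> + 2 * \<eta>) * ?D\<bar> \<le> 4 * (\<xi>\<^sup>2 + \<eta>\<^sup>2)" 
    using zero_le_power2[of \<xi>] zero_le_power2[of \<eta>] by (simp only: abs_le_iff) argo
  then show ?thesis
    using drift_inner[OF \<eta>_def, of "\<xi> + 2 * \<eta>"] unfolding norm_sq_2
    by (simp add: \<xi>_def \<eta>_def abs_minus_commute add.commute)
qed

text \<open>The second moment of \<open>T\<close> under \<open>g\<close> is the second moment of \<open>f\<close>.\<close>
lemma integrable_displacement:
  assumes g: "g \<in> borel_measurable borel" "\<And>z. 0 \<le> g z" and T: "T \<in> borel_measurable borel"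
    and push: "distr (meas g) borel T = meas f" and f: "meas f \<in> P2"
    and mom: "integrable lborel (\<lambda>z. (norm z)\<^sup>2 * g z)"
  shows "integrable lborel (\<lambda>z. (norm (T z - z))\<^sup>2 * g z)"
proof -
  note [measurable] = g(1) T
  have "(\<integral>\<^sup>+ z. ennreal ((norm z)\<^sup>2) \<partial>meas f) < \<infinity>" using f unfolding P2_def by simp
  also have "(\<integral>\<^sup>+ z. ennreal ((norm z)\<^sup>2) \<partial>meas f) = (\<integral>\<^sup>+ z. ennreal ((norm (T z))\<^sup>2) \<partial>meas g)"
    unfolding push[symmetric] by (rule nn_integral_distr) (auto simp: meas_def)
  also have "\<dots> = (\<integral>\<^sup>+ z. ennreal (norm ((norm (T z))\<^sup>2 * g z)) \<partial>lborel)"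
    unfolding meas_def
    by (subst nn_integral_density) (use g(2) in \<open>auto simp: ennreal_mult[symmetric] mult.commute\<close>)
  finally have "integrable lborel (\<lambda>z. (norm (T z))\<^sup>2 * g z)"
    by (intro integrableI_bounded) auto
  with mom have "integrable lborel (\<lambda>z. 2 * ((norm (T z))\<^sup>2 * g z) + 2 * ((norm z)\<^sup>2 * g z))" by auto
  then show ?thesis
  proof (rule Bochner_Integration.integrable_bound)
    show "AE z in lborel. norm ((norm (T z - z))\<^sup>2 * g z) \<le>
        norm (2 * ((norm (T z))\<^sup>2 * g z) + 2 * ((norm z)\<^sup>2 * g z))"
    proof (rule AE_I2)
      fix z
      have "(norm (T z - z))\<^sup>2 \<le> (norm (T z) + norm z)\<^sup>2"
        by (intro power_mono norm_triangle_ineq4) simp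
      also have "\<dots> \<le> 2 * (norm (T z))\<^sup>2 + 2 * (norm z)\<^sup>2"
        using zero_le_power2[of "norm (T z) - norm z"] by (simp add: power2_eq_square algebra_simps)
      finally have "(norm (T z - z))\<^sup>2 * g z \<le> (2 * (norm (T z))\<^sup>2 + 2 * (norm z)\<^sup>2) * g z"
        using g(2) by (rule mult_right_mono)
      then show "norm ((norm (T z - z))\<^sup>2 * g z) \<le> norm (2 * ((norm (T z))\<^sup>2 * g z) + 2 * ((norm z)\<^sup>2 * g z))"
        using g(2)[of z] by (simp add: algebra_simps)
    qed
  qed measurable
qed

lemma J_fun_hypo_matrix:
  "J_fun U hypo_matrix g \<phi> =
    ereal (- (LINT z|lborel. inner_A hypo_matrix (drift U (transport_map hypo_matrix \<phi> z) - drift U z)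
        (transport_map hypo_matrix \<phi> z - z) * g z))
      + enn2ereal (\<integral>\<^sup>+ z. ennreal (dissipation (hess \<phi> z) * g z) \<partial>lborel)"
  unfolding J_fun_def Let_def dissipation_def by (simp only: hypo_matrix_entry)

context mildly_nonconvex_potential
begin

text \<open>If the dissipation is integrable, the inequality says that a single integral over the plane is nonnegative, and Fubini's
  theorem reduces it to lines of constant velocity. Otherwise \<open>\<J>\<close> is infinite.\<close>
lemma W_sq_le_J_fun:
  assumes mom: "integrable lborel (\<lambda>z. (norm z)\<^sup>2 * f_inf U z)"
    and f: "meas f \<in> P2" and opt: "optimal_potential hypo_matrix f (f_inf U) \<phi>"
  shows "ereal (\<beta> / 160) * enn2ereal (W_sq hypo_matrix (meas f) (meas (f_inf U)))
    \<le> J_fun U hypo_matrix (f_inf U) \<phi>"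
proof -
  define g where "g = f_inf U"
  define T where "T = transport_map hypo_matrix \<phi>"
  define N where "N = (\<lambda>z. inner_A hypo_matrix (z - T z) (z - T z))"
  define G where "G = (\<lambda>z. inner_A hypo_matrix (drift U (T z) - drift U z) (T z - z))"
  define Q where "Q = (\<lambda>z. dissipation (hess \<phi> z))"
  from opt have C2: "C2_plane \<phi>" and pos: "\<And>z. sym_pos_def (hess \<phi> z)"
    and push: "distr (meas g) borel T = meas f"
    and W: "W_sq hypo_matrix (meas f) (meas g) = (\<integral>\<^sup>+ z. ennreal (N z * g z) \<partial>lborel)"
    unfolding optimal_potential_def T_def N_def g_def by auto
  have cg: "continuous_on UNIV g" unfolding g_def by (intro continuous_f_inf continuous_U)
  have g0: "0 \<le> g z" for z unfolding g_def by (rule f_inf_nonneg)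
  have cT: "continuous_on UNIV T" unfolding T_def transport_map_def
    by (intro linear_continuous_on_compose[OF C2_planeD(1)[OF C2]] matrix_vector_mul_linear)
  have cT': "continuous_on UNIV (\<lambda>z. T z $ i)" for i using cT by (rule continuous_on_component)
  have cz: "continuous_on UNIV (\<lambda>z::real^2. z $ i)" for i by (intro continuous_on_component continuous_on_id)
  have cN: "continuous_on UNIV N" unfolding N_def inner_hypo_matrix vector_minus_component
    by (intro continuous_on_add continuous_on_mult continuous_on_diff continuous_on_const cT' cz)
  have cG: "continuous_on UNIV G"
    unfolding G_def inner_hypo_matrix vector_minus_component drift_def deriv_U vector_2
    by (intro continuous_on_add continuous_on_mult continuous_on_diff continuous_on_minus continuous_on_const
        continuous_dU_compose cT' cz)
  have cQ: "continuous_on UNIV Q" unfolding Q_def using continuous_dissipation[OF C2 pos] .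
  note [measurable] = borel_measurable_continuous_onI[OF cg] borel_measurable_continuous_onI[OF cT]
    borel_measurable_continuous_onI[OF cN] borel_measurable_continuous_onI[OF cG] borel_measurable_continuous_onI[OF cQ]
  have disp: "integrable lborel (\<lambda>z. (norm (T z - z))\<^sup>2 * g z)"
    by (rule integrable_displacement[OF _ g0 _ push f]) (use mom in \<open>auto simp: g_def[symmetric]\<close>)
  have bound: "integrable lborel (\<lambda>z. F z * g z)"
    if "F \<in> borel_measurable borel" "\<And>z. \<bar>F z\<bar> \<le> 5 * (norm (T z - z))\<^sup>2" for F :: "real^2 \<Rightarrow> real"
  proof (rule Bochner_Integration.integrable_bound[OF integrable_mult_right[OF disp, of 5]])
    show "AE z in lborel. norm (F z * g z) \<le> norm (5 * ((norm (T z - z))\<^sup>2 * g z))"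
      using mult_right_mono[OF that(2) g0] by (auto simp: abs_mult abs_of_nonneg[OF g0] mult.assoc)
  qed (use that(1) in measurable)
  have iN: "integrable lborel (\<lambda>z. N z * g z)"
  proof (rule bound)
    show "\<bar>N z\<bar> \<le> 5 * (norm (T z - z))\<^sup>2" for z
      using inner_hypo_matrix_le[of "z - T z"] by (simp add: N_def norm_minus_commute)
  qed measurable
  have iG: "integrable lborel (\<lambda>z. G z * g z)"
  proof (rule bound)
    fix z
    have "\<bar>G z\<bar> \<le> 4 * (norm (T z - z))\<^sup>2" unfolding G_def by (rule drift_inner_le)
    then show "\<bar>G z\<bar> \<le> 5 * (norm (T z - z))\<^sup>2" using zero_le_power2[of "norm (T z - z)"] by linarith
  qed measurable
  have N0: "0 \<le> N z" for z
    using sym_pos_def_hypo_matrix unfolding N_def inner_A_def sym_pos_def_def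
    by (cases "z - T z = 0") (auto simp: less_imp_le)
  have Q0: "0 \<le> Q z" for z unfolding Q_def by (rule dissipation_nonneg[OF pos])
  have W': "enn2ereal (W_sq hypo_matrix (meas f) (meas g)) = ereal (LINT z|lborel. N z * g z)"
  proof -
    have "W_sq hypo_matrix (meas f) (meas g) = ennreal (LINT z|lborel. N z * g z)"
      unfolding W using iN N0 g0 by (intro nn_integral_eq_integral) auto
    then show ?thesis using N0 g0 by (simp add: enn2ereal_ennreal integral_nonneg)
  qed
  have J: "J_fun U hypo_matrix g \<phi> = ereal (- (LINT z|lborel. G z * g z)) + enn2ereal (\<integral>\<^sup>+ z. ennreal (Q z * g z) \<partial>lborel)"
    unfolding J_fun_hypo_matrix G_def T_def Q_def ..
  show ?thesis
  proof (cases "(\<integral>\<^sup>+ z. ennreal (Q z * g z) \<partial>lborel) = \<infinity>")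
    case True
    then show ?thesis unfolding g_def[symmetric] J by simp
  next
    case False
    then have iQ: "integrable lborel (\<lambda>z. Q z * g z)"
      using Q0 g0 by (intro integrableI_bounded) (auto simp: less_top[symmetric])
    have JQ: "enn2ereal (\<integral>\<^sup>+ z. ennreal (Q z * g z) \<partial>lborel) = ereal (LINT z|lborel. Q z * g z)"
      using nn_integral_eq_integral[OF iQ] Q0 g0 by (simp add: enn2ereal_ennreal integral_nonneg)
    let ?P = "\<lambda>z. Q z - G z - \<beta> / 160 * N z"
    have eq: "(\<lambda>z. ?P z * g z) = (\<lambda>z. Q z * g z - G z * g z - \<beta> / 160 * (N z * g z))"
      by (auto simp: algebra_simps)
    have "0 \<le> (LINT z|lborel. ?P z * g z)"
    proof (rule integral_plane_nonneg)
      show "integrable lborel (\<lambda>z. ?P z * g z)" unfolding eq using iQ iG iN by auto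
      fix v
      define k where "k = exp (- v\<^sup>2 / 2) / (sqrt (2 * pi) * (LINT y|lborel. exp (- U y)))"
      have k: "0 \<le> k" unfolding k_def by (intro divide_nonneg_nonneg mult_nonneg_nonneg integral_nonneg) auto
      have gk: "g (pt x v) = exp (- U x) * k" for x unfolding g_def k_def by (rule f_inf_pt)
      assume "integrable lborel (\<lambda>x. ?P (pt x v) * g (pt x v))"
      moreover have "continuous_on UNIV (\<lambda>x. ?P (pt x v) * g (pt x v))"
      proof -
        have "continuous_on UNIV (\<lambda>z. ?P z * g z)"
          by (intro continuous_on_mult continuous_on_diff continuous_on_const cQ cG cN cg)
        then show ?thesis
          by (rule continuous_on_compose2) (auto intro!: continuous_on_pt continuous_on_id continuous_on_const)
      qed
      ultimately show "0 \<le> (LINT x|lborel. ?P (pt x v) * g (pt x v))"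
        using section_nonneg[OF C2 pos k, of v] unfolding gk Q_def G_def N_def T_def by simp
    qed
    also have "(LINT z|lborel. ?P z * g z) =
        (LINT z|lborel. Q z * g z) - (LINT z|lborel. G z * g z) - \<beta> / 160 * (LINT z|lborel. N z * g z)"
      unfolding eq using iQ iG iN by simp
    finally show ?thesis unfolding g_def[symmetric] J JQ W' by simp
  qed
qed

end

section \<open>The inequality for the kinetic Fokker--Planck equation\<close>

theorem proposition2p3:
  fixes U \<psi> :: "real \<Rightarrow> real" and \<alpha> R :: real
  assumes "\<alpha> > 0" and "R > 0"
    and "C2_line \<psi>" and "\<forall>x. x \<notin> {-R..R} \<longrightarrow> \<psi> x = 0"
    and "\<forall>x. U x = \<alpha> * (\<bar>x\<bar>\<^sup>2 / 2) + \<psi> x"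
    and "smallness \<alpha> \<psi> R"
  shows "\<exists>A \<kappa>. sym_pos_def A \<and> \<kappa> > 0 \<and>
    (\<forall>f \<phi>. meas f \<in> P2 \<and> C1_plane f \<and> (\<forall>z. f z > 0) \<and> optimal_potential A f (f_inf U) \<phi> \<longrightarrow>
       ereal \<kappa> * enn2ereal (W_sq A (meas f) (meas (f_inf U))) \<le> J_fun U A (f_inf U) \<phi>)"
proof -
  define m where "m = Linf_norm (deriv (deriv \<psi>))"
  define \<beta> where "\<beta> = \<alpha> - 2 * Linf_norm (deriv \<psi>)"
  interpret mildly_nonconvex_potential U "deriv U" m \<beta> "m - \<alpha>" R
    unfolding m_def \<beta>_def by (rule mildly_nonconvex_of_smallness(1)[OF assms])
  have "integrable lborel (\<lambda>z. (norm z)\<^sup>2 * f_inf U z)"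
    using assms(1,5) mildly_nonconvex_of_smallness(2)[OF assms] continuous_U
    by (intro integrable_second_moment_f_inf[where \<alpha> = \<alpha> and \<psi> = \<psi>]) auto
  then have "\<forall>f \<phi>. meas f \<in> P2 \<and> C1_plane f \<and> (\<forall>z. f z > 0) \<and> optimal_potential hypo_matrix f (f_inf U) \<phi> \<longrightarrow>
       ereal (\<beta> / 160) * enn2ereal (W_sq hypo_matrix (meas f) (meas (f_inf U))) \<le> J_fun U hypo_matrix (f_inf U) \<phi>"
    using W_sq_le_J_fun by blast
  then show ?thesis using sym_pos_def_hypo_matrix \<beta>(1) by (intro exI[of _ hypo_matrix] exI[of _ "\<beta> / 160"]) simp
qed

end
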